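(* Let $\mathfrak{L}=(\bigoplus_{i=1}^m \mathfrak{g}_i)\ltimes(\bigoplus_{k=1}^n I_k)$ be a finite-dimensional indecomposable semisimple Leibniz algebra over a field $\mathbb{K}$ of characteristic zero, where $\mathfrak{g}_1,\dots,\mathfrak{g}_m$ are simple Lie algebras and $\mathrm{Leib}(\mathfrak{L})=\bigoplus_{k=1}^n I_k$ is a decomposition into simple $\bigoplus_{i=1}^m\mathfrak{g}_i$-modules. The ideals of $\mathfrak{L}$ are the following: (i) abelian ideals $\bigoplus_{k\in A} I_k$, for any subset $A\subseteq\{1,\dots,n\}$; (ii) non-solvable ideals $(\bigoplus_{i\in B}\mathfrak{g}_i)\ltimes(\bigoplus_{j\in N(B)} I_j)\oplus(\bigoplus_{k\in C} I_k)$, where $\emptyset\ne B\subseteq\{1,\dots,m\}$ and $C\subseteq\{1,\dots,n\}\setminus N(B)$.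
   Context: A Leibniz algebra is a vector space $\mathfrak{L}$ with a bilinear bracket satisfying $[[x,y],z]=[[x,z],y]+[x,[y,z]]$; ideals are two-sided. The Leibniz kernel $\mathrm{Leib}(\mathfrak{L})$ is the two-sided ideal spanned by the squares $[x,x]$; the quotient $\mathfrak{g}_L=\mathfrak{L}/\mathrm{Leib}(\mathfrak{L})$ is a Lie algebra, called the liezation. $\mathrm{rad}(\mathfrak{L})$ is the maximal solvable ideal (solvable: $K^{(m)}=0$ for some $m$, where $K^{(0)}=K$, $K^{(j)}=[K^{(j-1)},K^{(j-1)}]$). $\mathfrak{L}$ is semisimple if $\mathrm{rad}(\mathfrak{L})=\mathrm{Leib}(\mathfrak{L})$. For semisimple $\mathfrak{L}$ one has $\mathfrak{L}=\mathfrak{g}_L\ltimes\mathrm{Leib}(\mathfrak{L})$ with $\mathfrak{g}_L$ realized as a semisimple Lie subalgebra; $\mathfrak{g}_L=\bigoplus_{i=1}^m\mathfrak{g}_i$ is a direct sum of simple Lie subalgebras and $\mathrm{Leib}(\mathfrak{L})=\bigoplus_{k=1}^n I_k$ is a direct sum of simple $\mathfrak{g}_L$-submodules (the action being $[I_k,\mathfrak{g}_L]$). $\mathfrak{L}$ is indecomposable if it is not a direct sum of two nonzero ideals. Associate to $\mathfrak{L}$ the bipartite graph with bipartition $(\{\mathfrak{g}_1,\dots,\mathfrak{g}_m\},\{I_1,\dots,I_n\})$ and an edge between $\mathfrak{g}_i$ and $I_j$ whenever $[I_j,\mathfrak{g}_i]=I_j$ (for indecomposable semisimple $\mathfrak{L}$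 this graph is connected). For $B\subseteq\{1,\dots,m\}$, $N(B)\subseteq\{1,\dots,n\}$ denotes the set of indices $j$ such that $I_j$ is adjacent to $\mathfrak{g}_i$ for at least one $i\in B$.
   Formalization: That every ideal is listed is false for a fixed decomposition if some I_k are isomorphic (diagonal in V+V over sl_2); here each ideal has the listed form for some decomposition into simple modules I'_k isomorphic to I_k, with I'_k = I_k whenever I_k is isomorphic to no other I_l. *)

theory Defs
  imports Complex_Main "HOL-Library.Set_Algebras"
begin

text \<open>
  A Leibniz algebra is the whole type 'a with scalar multiplication sc and bracket br;
  subalgebras, ideals and modules are subsets of it.  From Set_Algebras, X + Y and
  (\<Sum>k\<in>A. F k) are elementwise sums of sets, with empty sum {0}.
\<close>

text \<open>Right Leibniz algebras: right multiplications are derivations.\<close>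

locale leibniz_algebra = vector_space sc
  for sc :: "'k::field \<Rightarrow> 'a::ab_group_add \<Rightarrow> 'a" +
  fixes br :: "'a \<Rightarrow> 'a \<Rightarrow> 'a"
  assumes linear_left: "Vector_Spaces.linear sc sc (\<lambda>x. br x y)"
    and linear_right: "Vector_Spaces.linear sc sc (\<lambda>y. br x y)"
    and leibniz: "br (br x y) z = br (br x z) y + br x (br y z)"

definition bracket_span ::
  "('k::field \<Rightarrow> 'a::ab_group_add \<Rightarrow> 'a) \<Rightarrow> ('a \<Rightarrow> 'a \<Rightarrow> 'a) \<Rightarrow> 'a set \<Rightarrow> 'a set \<Rightarrow> 'a set" where
  "bracket_span sc br X Y = module.span sc {br x y | x y. x \<in> X \<and> y \<in> Y}"

definition subalgebra ::
  "('k::field \<Rightarrow> 'a::ab_group_add \<Rightarrow> 'a) \<Rightarrow> ('a \<Rightarrow> 'a \<Rightarrow> 'a) \<Rightarrow> 'a set \<Rightarrow> bool" where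
  "subalgebra sc br S \<longleftrightarrow> module.subspace sc S \<and> (\<forall>x\<in>S. \<forall>y\<in>S. br x y \<in> S)"

definition ideal_of ::
  "('k::field \<Rightarrow> 'a::ab_group_add \<Rightarrow> 'a) \<Rightarrow> ('a \<Rightarrow> 'a \<Rightarrow> 'a) \<Rightarrow> 'a set \<Rightarrow> 'a set \<Rightarrow> bool" where
  "ideal_of sc br S J \<longleftrightarrow> module.subspace sc J \<and> J \<subseteq> S \<and>
     (\<forall>x\<in>S. \<forall>y\<in>J. br x y \<in> J \<and> br y x \<in> J)"

abbreviation leibniz_ideal ::
  "('k::field \<Rightarrow> 'a::ab_group_add \<Rightarrow> 'a) \<Rightarrow> ('a \<Rightarrow> 'a \<Rightarrow> 'a) \<Rightarrow> 'a set \<Rightarrow> bool" where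
  "leibniz_ideal sc br J \<equiv> ideal_of sc br UNIV J"

definition abelian_subset :: "('a::ab_group_add \<Rightarrow> 'a \<Rightarrow> 'a) \<Rightarrow> 'a set \<Rightarrow> bool" where
  "abelian_subset br J \<longleftrightarrow> (\<forall>x\<in>J. \<forall>y\<in>J. br x y = 0)"

primrec derived_series ::
  "('k::field \<Rightarrow> 'a::ab_group_add \<Rightarrow> 'a) \<Rightarrow> ('a \<Rightarrow> 'a \<Rightarrow> 'a) \<Rightarrow> 'a set \<Rightarrow> nat \<Rightarrow> 'a set" where
  "derived_series sc br K 0 = K"
| "derived_series sc br K (Suc j) =
     bracket_span sc br (derived_series sc br K j) (derived_series sc br K j)"

definition solvable ::
  "('k::field \<Rightarrow> 'a::ab_group_add \<Rightarrow> 'a) \<Rightarrow> ('a \<Rightarrow> 'a \<Rightarrow> 'a) \<Rightarrow> 'a set \<Rightarrow> bool" where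
  "solvable sc br K \<longleftrightarrow> (\<exists>j. derived_series sc br K j = {0})"

text \<open>
  The linear span of the squares is a two-sided ideal by the Leibniz identity.
\<close>

definition leibniz_kernel ::
  "('k::field \<Rightarrow> 'a::ab_group_add \<Rightarrow> 'a) \<Rightarrow> ('a \<Rightarrow> 'a \<Rightarrow> 'a) \<Rightarrow> 'a set" where
  "leibniz_kernel sc br = module.span sc (range (\<lambda>x. br x x))"

text \<open>
  Greatest with respect to inclusion; it exists in finite dimension, since the sum of two
  solvable ideals is a solvable ideal.
\<close>

definition radical ::
  "('k::field \<Rightarrow> 'a::ab_group_add \<Rightarrow> 'a) \<Rightarrow> ('a \<Rightarrow> 'a \<Rightarrow> 'a) \<Rightarrow> 'a set" where
  "radical sc br = (GREATEST R. leibniz_ideal sc br R \<and> solvable sc br R)"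

definition semisimple_leibniz ::
  "('k::field \<Rightarrow> 'a::ab_group_add \<Rightarrow> 'a) \<Rightarrow> ('a \<Rightarrow> 'a \<Rightarrow> 'a) \<Rightarrow> bool" where
  "semisimple_leibniz sc br \<longleftrightarrow> radical sc br = leibniz_kernel sc br"

definition indecomposable_leibniz ::
  "('k::field \<Rightarrow> 'a::ab_group_add \<Rightarrow> 'a) \<Rightarrow> ('a \<Rightarrow> 'a \<Rightarrow> 'a) \<Rightarrow> bool" where
  "indecomposable_leibniz sc br \<longleftrightarrow>
     \<not> (\<exists>J J'. leibniz_ideal sc br J \<and> leibniz_ideal sc br J' \<and> J \<noteq> {0} \<and> J' \<noteq> {0} \<and>
          J + J' = UNIV \<and> J \<inter> J' = {0})"

text \<open>The Jacobi identity on S follows from the Leibniz identity and antisymmetry.\<close>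

definition simple_lie_subalgebra ::
  "('k::field \<Rightarrow> 'a::ab_group_add \<Rightarrow> 'a) \<Rightarrow> ('a \<Rightarrow> 'a \<Rightarrow> 'a) \<Rightarrow> 'a set \<Rightarrow> bool" where
  "simple_lie_subalgebra sc br S \<longleftrightarrow>
     subalgebra sc br S \<and> (\<forall>x\<in>S. br x x = 0) \<and> \<not> abelian_subset br S \<and>
     (\<forall>J. ideal_of sc br S J \<longrightarrow> J = {0} \<or> J = S)"

text \<open>The sum of the F k over k in A is direct.\<close>

definition independent_family :: "'i set \<Rightarrow> ('i \<Rightarrow> 'a::ab_group_add set) \<Rightarrow> bool" where
  "independent_family A F \<longleftrightarrow>
     (\<forall>x. (\<forall>k\<in>A. x k \<in> F k) \<and> (\<Sum>k\<in>A. x k) = 0 \<longrightarrow> (\<forall>k\<in>A. x k = 0))"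

text \<open>Modules over a subalgebra S are right modules: y in S acts by x \<mapsto> [x, y].\<close>

definition submodule_of ::
  "('k::field \<Rightarrow> 'a::ab_group_add \<Rightarrow> 'a) \<Rightarrow> ('a \<Rightarrow> 'a \<Rightarrow> 'a) \<Rightarrow> 'a set \<Rightarrow> 'a set \<Rightarrow> bool" where
  "submodule_of sc br S M \<longleftrightarrow> module.subspace sc M \<and> (\<forall>x\<in>M. \<forall>y\<in>S. br x y \<in> M)"

definition simple_module ::
  "('k::field \<Rightarrow> 'a::ab_group_add \<Rightarrow> 'a) \<Rightarrow> ('a \<Rightarrow> 'a \<Rightarrow> 'a) \<Rightarrow> 'a set \<Rightarrow> 'a set \<Rightarrow> bool" where
  "simple_module sc br S M \<longleftrightarrow> submodule_of sc br S M \<and> M \<noteq> {0} \<and>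
     (\<forall>N. submodule_of sc br S N \<and> N \<subseteq> M \<longrightarrow> N = {0} \<or> N = M)"

definition module_iso ::
  "('k::field \<Rightarrow> 'a::ab_group_add \<Rightarrow> 'a) \<Rightarrow> ('a \<Rightarrow> 'a \<Rightarrow> 'a) \<Rightarrow> 'a set \<Rightarrow> 'a set \<Rightarrow> 'a set \<Rightarrow> bool" where
  "module_iso sc br S M N \<longleftrightarrow>
     (\<exists>f. bij_betw f M N \<and> (\<forall>x\<in>M. \<forall>y\<in>M. f (x + y) = f x + f y) \<and>
          (\<forall>c. \<forall>x\<in>M. f (sc c x) = sc c (f x)) \<and> (\<forall>x\<in>M. \<forall>y\<in>S. f (br x y) = br (f x) y))"

definition simple_module_decomposition ::
  "('k::field \<Rightarrow> 'a::ab_group_add \<Rightarrow> 'a) \<Rightarrow> ('a \<Rightarrow> 'a \<Rightarrow> 'a) \<Rightarrow> 'a set \<Rightarrow> 'a set \<Rightarrow> nat \<Rightarrow>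
     (nat \<Rightarrow> 'a set) \<Rightarrow> bool" where
  "simple_module_decomposition sc br S M n I \<longleftrightarrow>
     (\<forall>k\<in>{1..n}. simple_module sc br S (I k)) \<and> independent_family {1..n} I \<and>
     M = (\<Sum>k\<in>{1..n}. I k)"

definition simple_lie_decomposition ::
  "('k::field \<Rightarrow> 'a::ab_group_add \<Rightarrow> 'a) \<Rightarrow> ('a \<Rightarrow> 'a \<Rightarrow> 'a) \<Rightarrow> 'a set \<Rightarrow> nat \<Rightarrow>
     (nat \<Rightarrow> 'a set) \<Rightarrow> bool" where
  "simple_lie_decomposition sc br S m g \<longleftrightarrow>
     (\<forall>i\<in>{1..m}. simple_lie_subalgebra sc br (g i)) \<and> independent_family {1..m} g \<and>
     (\<forall>i\<in>{1..m}. \<forall>j\<in>{1..m}. i \<noteq> j \<longrightarrow> (\<forall>x\<in>g i. \<forall>y\<in>g j. br x y = 0)) \<and>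
     S = (\<Sum>i\<in>{1..m}. g i)"

text \<open>The bipartite graph on the simple Lie summands g i and the simple modules I j.\<close>

definition adjacent ::
  "('k::field \<Rightarrow> 'a::ab_group_add \<Rightarrow> 'a) \<Rightarrow> ('a \<Rightarrow> 'a \<Rightarrow> 'a) \<Rightarrow> (nat \<Rightarrow> 'a set) \<Rightarrow> (nat \<Rightarrow> 'a set) \<Rightarrow>
     nat \<Rightarrow> nat \<Rightarrow> bool" where
  "adjacent sc br g I i j \<longleftrightarrow> bracket_span sc br (I j) (g i) = I j"

definition neighbours ::
  "('k::field \<Rightarrow> 'a::ab_group_add \<Rightarrow> 'a) \<Rightarrow> ('a \<Rightarrow> 'a \<Rightarrow> 'a) \<Rightarrow> (nat \<Rightarrow> 'a set) \<Rightarrow> (nat \<Rightarrow> 'a set) \<Rightarrow>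
     nat \<Rightarrow> nat set \<Rightarrow> nat set" where
  "neighbours sc br g I n B = {j \<in> {1..n}. \<exists>i\<in>B. adjacent sc br g I i j}"

end

theory Submission
  imports Defs
begin

text \<open>
  Everything rests on the asymmetry of the bracket: right multiplication by a square vanishes, so
  the Leibniz kernel \<open>K\<close> satisfies \<open>[L, K] = 0\<close> (lemma \<open>br_kernel\<close>).  Hence the only
  products that matter are those inside the Lie algebra \<open>G\<close> and the right action of \<open>G\<close> on \<open>K\<close>.  In
  particular, every \<open>G\<close>-submodule of \<open>K\<close> is an abelian ideal, and for an ideal \<open>X\<close> of \<open>G\<close> and a
  submodule \<open>V\<close> of \<open>K\<close> the sum \<open>X + V\<close> is an ideal as soon as \<open>[K, X] \<subseteq> V\<close>
  (\<open>semidirect_ideal\<close>).  As \<open>[I j, g i]\<close> is a submodule of the simple module \<open>I j\<close>, it is all of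
  \<open>I j\<close> or zero; so for \<open>X = (\<Sum>i\<in>B. g i)\<close> the condition says that \<open>V\<close> contains \<open>I j\<close> for all \<open>j\<close> in
  \<open>N(B)\<close>.  Such an ideal contains a perfect subalgebra \<open>g i\<close>, hence is not solvable.

  Conversely, let \<open>J\<close> be an ideal.  Its projection \<open>P\<close> to \<open>G\<close> is an ideal of \<open>G\<close>, hence a sum of
  some of the \<open>g i\<close> (\<open>ideal_of_G_eq\<close>).  If \<open>a + u \<in> J\<close> with \<open>a \<in> P\<close> and \<open>u \<in> K\<close>, then
  \<open>[b, a] = [b, a + u] \<in> J\<close> because \<open>[b, u] = 0\<close>; since each \<open>g i\<close> is perfect, the summands of \<open>P\<close>
  lie in \<open>J\<close> themselves.  Thus \<open>J = P + (J \<inter> K)\<close> (\<open>leibniz_ideal_eq\<close>), and \<open>J \<inter> K\<close> contains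
  \<open>[I j, g i] = I j\<close> whenever \<open>g i \<subseteq> P\<close> and \<open>j\<close> is adjacent to \<open>i\<close>.

  It remains to write the submodule \<open>J \<inter> K\<close> as a partial sum.  If two of the
  simple summands are isomorphic, there are diagonal submodules, which are not partial sums of the
  given decomposition.  But the decomposition can be adapted to a given submodule \<open>W\<close>
  (\<open>submodule_adapted_decomposition\<close>): some partial sum of the \<open>I k\<close> is a complement of \<open>W\<close>, and
  the projection to \<open>W\<close> along that complement carries the other summands isomorphically to
  summands of \<open>W\<close>.  By Schur's lemma it fixes such a summand pointwise when no other \<open>I k\<close> is
  isomorphic to it.
\<close>

section \<open>Sums of families of subspaces\<close>

text \<open>
  Index sets such as \<open>{1..n}\<close> enter only as finite sets; with these rules switched off the simplifier
  does not rewrite their bounds and membership into inequalities.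
\<close>

declare One_nat_def [simp del] atLeastAtMost_iff [simp del]

lemma in_set_plus_iff: "x \<in> A + B \<longleftrightarrow> (\<exists>a\<in>A. \<exists>b\<in>B. x = a + b)"
  by (auto simp: set_plus_def)

lemma in_sum_family_iff:
  assumes "finite A"
  shows "x \<in> (\<Sum>k\<in>A. F k) \<longleftrightarrow> (\<exists>f. (\<forall>k\<in>A. f k \<in> F k) \<and> x = (\<Sum>k\<in>A. f k))"
  using set_sum_alt[OF assms, of F] by auto

lemma sum_in_sum_family:
  assumes "finite A" "\<And>k. k \<in> A \<Longrightarrow> f k \<in> F k"
  shows "(\<Sum>k\<in>A. f k) \<in> (\<Sum>k\<in>A. F k)"
  using assms by (auto simp: in_sum_family_iff)

lemma (in module) subspace_set_plus:
  assumes "subspace X" "subspace Y"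
  shows "subspace (X + Y)"
  unfolding subspace_def
proof (intro conjI ballI allI)
  show "0 \<in> X + Y"
    using assms subspace_0 set_plus_intro[of 0 X 0 Y] by simp
next
  fix x y assume "x \<in> X + Y" "y \<in> X + Y"
  then obtain a b c d where "a \<in> X" "b \<in> Y" "c \<in> X" "d \<in> Y" "x = a + b" "y = c + d"
    by (auto simp: in_set_plus_iff)
  moreover have "x + y = (a + c) + (b + d)"
    using calculation by (simp add: algebra_simps)
  ultimately show "x + y \<in> X + Y"
    using assms by (metis set_plus_intro subspace_add)
next
  fix c x assume "x \<in> X + Y"
  then obtain a b where "a \<in> X" "b \<in> Y" "x = a + b"
    by (auto simp: in_set_plus_iff)
  then show "c *s x \<in> X + Y"
    using assms by (auto simp: scale_right_distrib intro!: set_plus_intro subspace_scale)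
qed

lemma (in module) subspace_sum_family:
  assumes "\<And>k. k \<in> A \<Longrightarrow> subspace (F k)"
  shows "subspace (\<Sum>k\<in>A. F k)"
  using assms
  by (induction A rule: infinite_finite_induct) (auto simp: subspace_set_plus)

lemma (in module) summand_subset_sum_family:
  assumes "finite A" "k \<in> A" "\<And>k. k \<in> A \<Longrightarrow> subspace (F k)"
  shows "F k \<subseteq> (\<Sum>k\<in>A. F k)"
proof
  fix x assume "x \<in> F k"
  then have "(\<forall>l\<in>A. (if l = k then x else 0) \<in> F l) \<and> x = (\<Sum>l\<in>A. if l = k then x else 0)"
    using assms subspace_0 by auto
  then show "x \<in> (\<Sum>k\<in>A. F k)"
    unfolding in_sum_family_iff[OF assms(1)] by (intro exI[of _ "\<lambda>l. if l = k then x else 0"])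
qed

lemma (in module) sum_family_least:
  assumes "subspace X" "\<And>k. k \<in> A \<Longrightarrow> F k \<subseteq> X" "finite A"
  shows "(\<Sum>k\<in>A. F k) \<subseteq> X"
  using assms by (auto simp: in_sum_family_iff intro!: subspace_sum[OF assms(1)]) blast

lemma (in module) sum_family_mono:
  assumes "finite B" "A \<subseteq> B" "\<And>k. k \<in> B \<Longrightarrow> subspace (F k)"
  shows "(\<Sum>k\<in>A. F k) \<subseteq> (\<Sum>k\<in>B. F k)"
  using assms finite_subset[OF assms(2,1)]
  by (intro sum_family_least subspace_sum_family summand_subset_sum_family) auto

lemma (in module) set_plus_least:
  assumes "subspace X" "A \<subseteq> X" "B \<subseteq> X"
  shows "A + B \<subseteq> X"
  using assms by (auto simp: in_set_plus_iff intro!: subspace_add)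

lemma independent_familyD:
  assumes "independent_family K F" "\<And>k. k \<in> K \<Longrightarrow> x k \<in> F k" "(\<Sum>k\<in>K. x k) = 0" "k \<in> K"
  shows "x k = 0"
  using assms unfolding independent_family_def by blast

lemma (in module) independent_family_subset:
  assumes "independent_family K F" "finite K" "A \<subseteq> K" "\<And>k. k \<in> K \<Longrightarrow> subspace (F k)"
  shows "independent_family A F"
  unfolding independent_family_def
proof (intro allI impI ballI)
  fix x k assume x: "(\<forall>k\<in>A. x k \<in> F k) \<and> (\<Sum>k\<in>A. x k) = 0" and k: "k \<in> A"
  let ?y = "\<lambda>k. if k \<in> A then x k else 0"
  have "(\<Sum>k\<in>K. ?y k) = (\<Sum>k\<in>A. x k)"
    using assms(2,3) by (intro sum.mono_neutral_cong_right) auto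
  then have sum0: "(\<Sum>k\<in>K. ?y k) = 0"
    using x by simp
  have "?y k \<in> F k" if "k \<in> K" for k
    using x subspace_0[OF assms(4)[OF that]] by simp
  then have "?y k = 0"
    using independent_familyD[OF assms(1) _ sum0] k assms(3) by blast
  then show "x k = 0"
    using k by simp
qed

lemma (in module) independent_family_Un:
  assumes "independent_family A F" "independent_family B F" "finite A" "finite B" "A \<inter> B = {}"
    and sub: "\<And>k. k \<in> A \<union> B \<Longrightarrow> subspace (F k)"
    and disj: "(\<Sum>k\<in>A. F k) \<inter> (\<Sum>k\<in>B. F k) = {0}"
  shows "independent_family (A \<union> B) F"
  unfolding independent_family_def
proof (intro allI impI)
  fix x assume "(\<forall>k\<in>A \<union> B. x k \<in> F k) \<and> (\<Sum>k\<in>A \<union> B. x k) = 0"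
  then have x: "\<And>k. k \<in> A \<Longrightarrow> x k \<in> F k" "\<And>k. k \<in> B \<Longrightarrow> x k \<in> F k"
    and "(\<Sum>k\<in>A \<union> B. x k) = 0"
    by simp_all
  then have sum0: "(\<Sum>k\<in>A. x k) + (\<Sum>k\<in>B. x k) = 0"
    using sum.union_disjoint[OF assms(3-5), of x] by simp
  then have "(\<Sum>k\<in>A. x k) = - (\<Sum>k\<in>B. x k)"
    by (simp add: eq_neg_iff_add_eq_0)
  moreover have "- (\<Sum>k\<in>B. x k) \<in> (\<Sum>k\<in>B. F k)"
    using assms(4) x(2) sub by (intro subspace_neg subspace_sum_family sum_in_sum_family) auto
  moreover have "(\<Sum>k\<in>A. x k) \<in> (\<Sum>k\<in>A. F k)"
    using assms(3) x(1) by (rule sum_in_sum_family)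
  ultimately have zeroA: "(\<Sum>k\<in>A. x k) = 0"
    using disj by (metis IntI singletonD)
  then have zeroB: "(\<Sum>k\<in>B. x k) = 0"
    using sum0 by simp
  show "\<forall>k\<in>A \<union> B. x k = 0"
    using independent_familyD[OF assms(1) x(1) zeroA] independent_familyD[OF assms(2) x(2) zeroB]
    by blast
qed

lemma (in module) independent_family_disjoint:
  assumes "independent_family K F" "finite K" "A \<subseteq> K" "D \<subseteq> K" "A \<inter> D = {}"
    and sub: "\<And>k. k \<in> K \<Longrightarrow> subspace (F k)"
  shows "(\<Sum>k\<in>A. F k) \<inter> (\<Sum>k\<in>D. F k) = {0}"
proof
  have fin: "finite A" "finite D"
    using assms(2) finite_subset[OF assms(3)] finite_subset[OF assms(4)] by auto
  show "{0} \<subseteq> (\<Sum>k\<in>A. F k) \<inter> (\<Sum>k\<in>D. F k)"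
    using assms(3,4) sub by (auto intro!: subspace_0 subspace_sum_family)
  show "(\<Sum>k\<in>A. F k) \<inter> (\<Sum>k\<in>D. F k) \<subseteq> {0}"
  proof
    fix x assume x: "x \<in> (\<Sum>k\<in>A. F k) \<inter> (\<Sum>k\<in>D. F k)"
    then obtain a where a: "\<And>k. k \<in> A \<Longrightarrow> a k \<in> F k" "x = (\<Sum>k\<in>A. a k)"
      unfolding Int_iff in_sum_family_iff[OF fin(1)] by blast
    obtain d where d: "\<And>k. k \<in> D \<Longrightarrow> d k \<in> F k" "x = (\<Sum>k\<in>D. d k)"
      using x unfolding Int_iff in_sum_family_iff[OF fin(2)] by blast
    define z where "z k = (if k \<in> A then a k else if k \<in> D then - d k else 0)" for k
    have "(\<Sum>k\<in>K. z k) = (\<Sum>k\<in>A \<union> D. z k)"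
      using assms by (intro sum.mono_neutral_right) (auto simp: z_def)
    also have "\<dots> = (\<Sum>k\<in>A. z k) + (\<Sum>k\<in>D. z k)"
      using fin assms(5) by (rule sum.union_disjoint)
    also have "(\<Sum>k\<in>A. z k) = x"
      unfolding a(2) by (intro sum.cong) (simp_all add: z_def)
    also have "(\<Sum>k\<in>D. z k) = (\<Sum>k\<in>D. - d k)"
      using assms(5) by (intro sum.cong) (auto simp: z_def)
    also have "x + (\<Sum>k\<in>D. - d k) = 0"
      unfolding d(2) by (simp add: sum_negf)
    finally have sum0: "(\<Sum>k\<in>K. z k) = 0" .
    have z_in: "z k \<in> F k" if "k \<in> K" for k
      using a(1)[of k] subspace_neg[OF sub[OF that] d(1)] subspace_0[OF sub[OF that]]
      by (simp add: z_def)
    have "a k = 0" if "k \<in> A" for k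
      using independent_familyD[OF assms(1) z_in sum0, of k] that assms(3) by (auto simp: z_def)
    then show "x \<in> {0}"
      unfolding a(2) by simp
  qed
qed

section \<open>Modules, homomorphisms and Schur's lemma\<close>

context leibniz_algebra
begin

lemma br_add_left: "br (x + y) z = br x z + br y z"
  and br_scale_left: "br (sc c x) z = sc c (br x z)"
proof -
  interpret Vector_Spaces.linear sc sc "\<lambda>x. br x z" by (rule linear_left)
  show "br (x + y) z = br x z + br y z" "br (sc c x) z = sc c (br x z)"
    by (rule add scale)+
qed

lemma br_add_right: "br z (x + y) = br z x + br z y"
  and br_scale_right: "br z (sc c x) = sc c (br z x)"
proof -
  interpret Vector_Spaces.linear sc sc "\<lambda>x. br z x" by (rule linear_right)
  show "br z (x + y) = br z x + br z y" "br z (sc c x) = sc c (br z x)"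
    by (rule add scale)+
qed

lemma br_zero_left [simp]: "br 0 z = 0"
  using br_add_left[of 0 0 z] by simp

lemma br_zero_right [simp]: "br z 0 = 0"
  using br_add_right[of z 0 0] by simp

lemma br_diff_left: "br (x - y) z = br x z - br y z"
  using br_add_left[of "x - y" y z] by (simp add: algebra_simps)

lemma br_sum_left: "br (\<Sum>k\<in>A. f k) z = (\<Sum>k\<in>A. br (f k) z)"
  by (induction A rule: infinite_finite_induct) (auto simp: br_add_left)

lemma br_sum_right: "br z (\<Sum>k\<in>A. f k) = (\<Sum>k\<in>A. br z (f k))"
  by (induction A rule: infinite_finite_induct) (auto simp: br_add_right)

lemma submodule_subspace: "submodule_of sc br S M \<Longrightarrow> subspace M"
  by (simp add: submodule_of_def)

lemma submodule_br: "submodule_of sc br S M \<Longrightarrow> x \<in> M \<Longrightarrow> y \<in> S \<Longrightarrow> br x y \<in> M"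
  by (simp add: submodule_of_def)

lemma submodule_zero: "submodule_of sc br S {0}"
  by (simp add: submodule_of_def)

lemma submodule_Int:
  "submodule_of sc br S M \<Longrightarrow> submodule_of sc br S N \<Longrightarrow> submodule_of sc br S (M \<inter> N)"
  by (simp add: submodule_of_def subspace_inter)

lemma submodule_plus:
  assumes "submodule_of sc br S M" "submodule_of sc br S N"
  shows "submodule_of sc br S (M + N)"
  using assms unfolding submodule_of_def
  by (auto simp: subspace_set_plus in_set_plus_iff br_add_left) blast

lemma submodule_sum_family:
  assumes "\<And>k. k \<in> A \<Longrightarrow> submodule_of sc br S (F k)"
  shows "submodule_of sc br S (\<Sum>k\<in>A. F k)"
  using assms
  by (induction A rule: infinite_finite_induct) (auto simp: submodule_plus submodule_zero)

lemma simple_module_submodule: "simple_module sc br S M \<Longrightarrow> submodule_of sc br S M"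
  by (simp add: simple_module_def)

lemma simple_moduleD:
  "simple_module sc br S M \<Longrightarrow> submodule_of sc br S N \<Longrightarrow> N \<subseteq> M \<Longrightarrow> N = {0} \<or> N = M"
  by (simp add: simple_module_def)

text \<open>
  Homomorphisms of right \<open>S\<close>-modules.  Since modules are subsets, the conditions are restricted to
  \<open>M\<close>; the values outside are arbitrary.
\<close>

definition equivariant_on :: "'a set \<Rightarrow> 'a set \<Rightarrow> ('a \<Rightarrow> 'a) \<Rightarrow> bool" where
  "equivariant_on S M f \<longleftrightarrow>
     (\<forall>x\<in>M. \<forall>y\<in>M. f (x + y) = f x + f y) \<and> (\<forall>c. \<forall>x\<in>M. f (sc c x) = sc c (f x)) \<and>
     (\<forall>x\<in>M. \<forall>y\<in>S. f (br x y) = br (f x) y)"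

lemma module_iso_iff: "module_iso sc br S M N \<longleftrightarrow> (\<exists>f. bij_betw f M N \<and> equivariant_on S M f)"
  by (simp add: module_iso_def equivariant_on_def)

lemma module_iso_refl: "module_iso sc br S M M"
  unfolding module_iso_iff by (intro exI[of _ id]) (simp add: equivariant_on_def)

lemma equivariant_on_subset: "equivariant_on S M f \<Longrightarrow> N \<subseteq> M \<Longrightarrow> equivariant_on S N f"
  unfolding equivariant_on_def by blast

lemma equivariant_on_zero:
  assumes "equivariant_on S M f" "submodule_of sc br S M"
  shows "f 0 = 0"
proof -
  have "0 \<in> M"
    using assms(2) by (intro subspace_0 submodule_subspace)
  then have "f (0 + 0) = f 0 + f 0"
    using assms(1) unfolding equivariant_on_def by blast
  then show ?thesis
    by simp
qed

lemma submodule_kernel: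
  assumes "equivariant_on S M f" "submodule_of sc br S M"
  shows "submodule_of sc br S {x \<in> M. f x = 0}"
  using assms equivariant_on_zero[OF assms]
  unfolding equivariant_on_def submodule_of_def subspace_def by auto

lemma submodule_preimage:
  assumes "equivariant_on S M f" "submodule_of sc br S M" "submodule_of sc br S N"
  shows "submodule_of sc br S {x \<in> M. f x \<in> N}"
  using assms equivariant_on_zero[OF assms(1,2)]
  unfolding equivariant_on_def submodule_of_def subspace_def by auto

lemma submodule_image:
  assumes "equivariant_on S M f" "submodule_of sc br S M"
  shows "submodule_of sc br S (f ` M)"
  unfolding submodule_of_def subspace_def
proof (intro conjI ballI allI)
  have f: "\<And>x y. x \<in> M \<Longrightarrow> y \<in> M \<Longrightarrow> f x + f y = f (x + y)"
    "\<And>c x. x \<in> M \<Longrightarrow> sc c (f x) = f (sc c x)"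
    "\<And>x y. x \<in> M \<Longrightarrow> y \<in> S \<Longrightarrow> br (f x) y = f (br x y)"
    using assms(1) unfolding equivariant_on_def by auto
  have M: "0 \<in> M" "\<And>x y. x \<in> M \<Longrightarrow> y \<in> M \<Longrightarrow> x + y \<in> M" "\<And>c x. x \<in> M \<Longrightarrow> sc c x \<in> M"
    "\<And>x y. x \<in> M \<Longrightarrow> y \<in> S \<Longrightarrow> br x y \<in> M"
    using assms(2) unfolding submodule_of_def subspace_def by auto
  show "0 \<in> f ` M"
    using M(1) equivariant_on_zero[OF assms] by (metis imageI)
  show "x + y \<in> f ` M" if "x \<in> f ` M" "y \<in> f ` M" for x y
    using that f M by auto
  show "sc c x \<in> f ` M" if "x \<in> f ` M" for c x
    using that f M by auto
  show "br x y \<in> f ` M" if "x \<in> f ` M" "y \<in> S" for x y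
    using that f M by auto
qed

lemma equivariant_on_inj:
  assumes "equivariant_on S M f" "submodule_of sc br S M" "\<And>x. x \<in> M \<Longrightarrow> f x = 0 \<Longrightarrow> x = 0"
  shows "inj_on f M"
proof (rule inj_onI)
  fix x y assume xy: "x \<in> M" "y \<in> M" "f x = f y"
  have M: "subspace M" using assms(2) by (rule submodule_subspace)
  have diff: "x - y \<in> M"
    using xy(1,2) by (rule subspace_diff[OF M])
  then have "f (x - y + y) = f (x - y) + f y"
    using assms(1) xy(2) unfolding equivariant_on_def by blast
  then have "f (x - y) = 0"
    using xy(3) by simp
  then show "x = y"
    using assms(3)[OF diff] by simp
qed

text \<open>
  The kernel of \<open>f\<close> is \<open>{0}\<close> or \<open>M\<close> by simplicity of \<open>M\<close>; in the first case the image is nonzero,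
  hence all of \<open>N\<close> by simplicity of \<open>N\<close>.
\<close>

lemma schur:
  assumes "simple_module sc br S M" "simple_module sc br S N"
    and f: "equivariant_on S M f" "f ` M \<subseteq> N"
  shows "(\<forall>x\<in>M. f x = 0) \<or> module_iso sc br S M N"
proof (cases "{x \<in> M. f x = 0} = M")
  case False
  have M: "submodule_of sc br S M"
    using assms(1) by (rule simple_module_submodule)
  have "{x \<in> M. f x = 0} = {0}"
    using simple_moduleD[OF assms(1) submodule_kernel[OF f(1) M]] False by auto
  then have "inj_on f M"
    by (intro equivariant_on_inj[OF f(1) M]) auto
  moreover have "f ` M \<noteq> {0}"
    using False equivariant_on_zero[OF f(1) M] subspace_0[OF submodule_subspace[OF M]] by auto
  then have "f ` M = N"
    using simple_moduleD[OF assms(2) submodule_image[OF f(1) M] f(2)] by simp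
  ultimately show ?thesis
    using f(1) by (auto simp: module_iso_iff bij_betw_def)
qed blast

lemma simple_module_image:
  assumes M: "simple_module sc br S M" and f: "equivariant_on S M f" "inj_on f M"
  shows "simple_module sc br S (f ` M)"
proof -
  have sub: "submodule_of sc br S M"
    using M by (rule simple_module_submodule)
  have zero: "f 0 = 0" "0 \<in> M"
    using equivariant_on_zero[OF f(1) sub] subspace_0[OF submodule_subspace[OF sub]] by auto
  have "f ` M \<noteq> {0}"
  proof
    assume *: "f ` M = {0}"
    have "M \<subseteq> {0}"
    proof
      fix x assume "x \<in> M"
      then have "f x \<in> f ` M" by (rule imageI)
      then have "f x = f 0" using * zero(1) by simp
      then show "x \<in> {0}" using inj_onD[OF f(2) _ \<open>x \<in> M\<close> zero(2)] by simp
    qed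
    then show False
      using M zero by (auto simp: simple_module_def)
  qed
  moreover have "N = {0} \<or> N = f ` M" if N: "submodule_of sc br S N" "N \<subseteq> f ` M" for N
  proof -
    let ?X = "{x \<in> M. f x \<in> N}"
    have eq: "f ` ?X = N"
      using N(2) by auto
    have "?X = {0} \<or> ?X = M"
      using submodule_preimage[OF f(1) sub N(1)] by (intro simple_moduleD[OF M]) auto
    then have "f ` ?X = f ` {0} \<or> f ` ?X = f ` M"
      by (elim disj_forward) (simp_all only:)
    then show ?thesis
      unfolding eq by (simp add: zero(1))
  qed
  ultimately show ?thesis
    using submodule_image[OF f(1) sub] by (simp add: simple_module_def)
qed

text \<open>
  For \<open>W \<inter> P = {0}\<close> this is the projection of \<open>W + P\<close> onto \<open>W\<close> along \<open>P\<close>.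
\<close>

definition component :: "'a set \<Rightarrow> 'a set \<Rightarrow> 'a \<Rightarrow> 'a" where
  "component W P x = (THE w. w \<in> W \<and> x - w \<in> P)"

lemma component_eq:
  assumes "subspace W" "subspace P" "W \<inter> P = {0}" "w \<in> W" "x - w \<in> P"
  shows "component W P x = w"
  unfolding component_def
proof (rule the_equality)
  fix w' assume w': "w' \<in> W \<and> x - w' \<in> P"
  have "w' - w \<in> W"
    using w' assms(4) subspace_diff[OF assms(1)] by blast
  moreover have "(x - w) - (x - w') \<in> P"
    using w' assms(5) subspace_diff[OF assms(2)] by blast
  then have "w' - w \<in> P"
    by simp
  ultimately have "w' - w \<in> W \<inter> P"
    by blast
  then show "w' = w"
    unfolding assms(3) by simp
qed (use assms in auto)

lemma component_in:
  assumes "subspace W" "subspace P" "W \<inter> P = {0}" "x \<in> W + P"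
  shows "component W P x \<in> W" "x - component W P x \<in> P"
proof -
  obtain w p where w: "w \<in> W" "p \<in> P" "x = w + p"
    using assms(4) unfolding in_set_plus_iff by blast
  have xw: "x - w \<in> P"
    using w(2,3) by simp
  have "component W P x = w"
    using assms(1-3) w(1) xw by (rule component_eq)
  then show "component W P x \<in> W" "x - component W P x \<in> P"
    using w(1) xw by metis+
qed

lemma equivariant_on_component:
  assumes "submodule_of sc br S W" "submodule_of sc br S P" "W \<inter> P = {0}"
  shows "equivariant_on S (W + P) (component W P)"
proof -
  let ?f = "component W P"
  have sub: "subspace W" "subspace P"
    using assms by (auto intro: submodule_subspace)
  note eq = component_eq[OF sub assms(3)]
  note f = component_in[OF sub assms(3)]
  show ?thesis
    unfolding equivariant_on_def
  proof (intro conjI ballI allI)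
    fix x y assume "x \<in> W + P" "y \<in> W + P"
    then have "?f x + ?f y \<in> W" "(x - ?f x) + (y - ?f y) \<in> P"
      by (blast intro: subspace_add[OF sub(1)] subspace_add[OF sub(2)] f)+
    then show "?f (x + y) = ?f x + ?f y"
      by (intro eq) (simp_all add: algebra_simps)
  next
    fix c x assume "x \<in> W + P"
    then have "sc c (?f x) \<in> W" "sc c (x - ?f x) \<in> P"
      by (blast intro: subspace_scale[OF sub(1)] subspace_scale[OF sub(2)] f)+
    then show "?f (sc c x) = sc c (?f x)"
      by (intro eq) (simp_all add: scale_right_diff_distrib)
  next
    fix x y assume "x \<in> W + P" "y \<in> S"
    then have "br (?f x) y \<in> W" "br (x - ?f x) y \<in> P"
      by (blast intro: submodule_br[OF assms(1)] submodule_br[OF assms(2)] f)+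
    then show "?f (br x y) = br (?f x) y"
      by (intro eq) (simp_all add: br_diff_left)
  qed
qed

lemma equivariant_on_diff:
  assumes "equivariant_on S M f" 
  shows "equivariant_on S M (\<lambda>x. x - f x)"
  using assms unfolding equivariant_on_def
  by (auto simp: br_diff_left scale_right_diff_distrib)

lemma equivariant_on_comp:
  assumes "equivariant_on S M f" "equivariant_on S N h" "f ` M \<subseteq> N"
  shows "equivariant_on S M (\<lambda>x. h (f x))"
  using assms unfolding equivariant_on_def by (auto simp: image_subset_iff)

text \<open>
  Composing \<open>f\<close> with the projection to a summand \<open>I l\<close> gives a homomorphism between two simple
  modules that are not isomorphic, which is zero by Schur's lemma.
\<close>

lemma hom_into_sum_eq_zero:
  assumes K: "finite K" "independent_family K I" "\<And>l. l \<in> K \<Longrightarrow> simple_module sc br S (I l)"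
    and M: "simple_module sc br S M" "\<And>l. l \<in> K \<Longrightarrow> \<not> module_iso sc br S M (I l)"
    and f: "equivariant_on S M f" "f ` M \<subseteq> (\<Sum>l\<in>K. I l)"
    and "x \<in> M"
  shows "f x = 0"
proof -
  have sub: "submodule_of sc br S (I l)" if "l \<in> K" for l
    using K(3)[OF that] by (rule simple_module_submodule)
  obtain y where y: "\<And>l. l \<in> K \<Longrightarrow> y l \<in> I l" "f x = (\<Sum>l\<in>K. y l)"
    using f(2) \<open>x \<in> M\<close> by (force simp: in_sum_family_iff K(1))
  have "y l = 0" if l: "l \<in> K" for l
  proof -
    define P where "P = (\<Sum>j\<in>K - {l}. I j)"
    have P: "submodule_of sc br S P"
      unfolding P_def using sub by (intro submodule_sum_family) auto
    have split: "(\<Sum>j\<in>K. I j) = I l + P"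
      unfolding P_def using K(1) l by (rule sum.remove)
    have disj: "I l \<inter> P = {0}"
      using independent_family_disjoint[OF K(2,1), of "{l}" "K - {l}"] l sub submodule_subspace
      unfolding P_def by auto
    have eqv: "equivariant_on S M (\<lambda>x. component (I l) P (f x))"
      using f split equivariant_on_component[OF sub[OF l] P disj]
      by (intro equivariant_on_comp[OF f(1)]) auto
    have "(\<lambda>x. component (I l) P (f x)) ` M \<subseteq> I l"
      using f(2) component_in(1)[OF _ _ disj] sub[OF l] P submodule_subspace
      unfolding split by blast
    then have "component (I l) P (f x) = 0"
      using schur[OF M(1) K(3)[OF l] eqv] M(2)[OF l] \<open>x \<in> M\<close> by blast
    moreover have "component (I l) P (f x) = y l"
    proof (rule component_eq[OF _ _ disj])
      have "f x - y l = (\<Sum>j\<in>K - {l}. y j)"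
        using y(2) K(1) l by (simp add: sum.remove)
      then show "f x - y l \<in> P"
        unfolding P_def using K(1) y(1) by (auto intro: sum_in_sum_family)
    qed (use sub[OF l] P y(1) l submodule_subspace in auto)
    ultimately show "y l = 0"
      by simp
  qed
  then show "f x = 0"
    using y(2) by simp
qed

section \<open>Submodules of a direct sum of simple modules\<close>

text \<open>
  \<open>D\<close> is a maximal set of indices whose partial sum meets \<open>W\<close> trivially.  Adding an index \<open>k\<close> destroys
  this, which produces a nonzero vector of \<open>I k\<close> in \<open>W + (\<Sum>k\<in>D. I k)\<close>; by simplicity \<open>I k\<close> lies in that sum.
\<close>

lemma exists_partial_sum_complement:
  assumes K: "finite K" "\<And>k. k \<in> K \<Longrightarrow> simple_module sc br S (I k)"
    and W: "submodule_of sc br S W" "W \<subseteq> (\<Sum>k\<in>K. I k)"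
  obtains D where "D \<subseteq> K" "W \<inter> (\<Sum>k\<in>D. I k) = {0}" "W + (\<Sum>k\<in>D. I k) = (\<Sum>k\<in>K. I k)"
proof -
  have sub: "submodule_of sc br S (I k)" if "k \<in> K" for k
    using K(2)[OF that] by (rule simple_module_submodule)
  have sW: "subspace W"
    using W(1) by (rule submodule_subspace)
  let ?\<D> = "{D. D \<subseteq> K \<and> W \<inter> (\<Sum>k\<in>D. I k) = {0}}"
  have "finite ?\<D>"
    using K(1) by simp
  moreover have "{} \<in> ?\<D>"
    using subspace_0[OF sW] by simp
  ultimately have "\<exists>D\<in>?\<D>. \<forall>E\<in>?\<D>. D \<subseteq> E \<longrightarrow> D = E"
    by (intro finite_has_maximal) blast+
  then obtain D where "D \<in> ?\<D>" and max: "\<forall>E\<in>?\<D>. D \<subseteq> E \<longrightarrow> D = E" ..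
  then have D: "D \<subseteq> K" "W \<inter> (\<Sum>k\<in>D. I k) = {0}"
    by simp_all
  let ?P = "\<Sum>k\<in>D. I k"
  have finD: "finite D"
    using D(1) K(1) finite_subset by blast
  have P: "submodule_of sc br S ?P"
    using D(1) sub by (intro submodule_sum_family) auto
  have sP: "subspace ?P"
    using P by (rule submodule_subspace)
  have WP: "submodule_of sc br S (W + ?P)"
    using W(1) P by (rule submodule_plus)
  have "I k \<subseteq> W + ?P" if k: "k \<in> K" for k
  proof (cases "k \<in> D")
    case True
    then have "I k \<subseteq> ?P"
      using D(1) sub submodule_subspace finD by (intro summand_subset_sum_family) auto
    then show ?thesis
      using set_zero_plus2[OF subspace_0[OF sW]] by blast
  next
    case False
    then have "insert k D \<notin> ?\<D>"
      using max by blast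
    then have "W \<inter> (\<Sum>l\<in>insert k D. I l) \<noteq> {0}"
      using k D(1) by blast
    moreover have "0 \<in> W \<inter> (\<Sum>l\<in>insert k D. I l)"
      using sW D(1) k sub submodule_subspace
      by (intro IntI subspace_0 subspace_sum_family) auto
    moreover have "(\<Sum>l\<in>insert k D. I l) = I k + ?P"
      using False finD by (rule sum.insert[rotated])
    ultimately obtain w where w: "w \<in> W" "w \<in> I k + ?P" "w \<noteq> 0"
      by blast
    obtain x p where xp: "x \<in> I k" "p \<in> ?P" "w = x + p"
      using w(2) unfolding in_set_plus_iff by blast
    have "x \<noteq> 0"
    proof
      assume "x = 0"
      then have "w \<in> W \<inter> ?P"
        using w(1) xp(2,3) by simp
      then show False
        using w(3) unfolding D(2) by simp
    qed
    moreover have "x \<in> W + ?P"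
    proof -
      have "x = w + (- p)" using xp(3) by simp
      then show ?thesis using w(1) subspace_neg[OF sP xp(2)] set_plus_intro by metis
    qed
    ultimately have "I k \<inter> (W + ?P) \<noteq> {0}"
      using xp(1) by blast
    then have "I k \<inter> (W + ?P) = I k"
      using simple_moduleD[OF K(2)[OF k] submodule_Int[OF sub[OF k] WP]] by blast
    then show ?thesis
      by blast
  qed
  then have "(\<Sum>k\<in>K. I k) \<subseteq> W + ?P"
    using submodule_subspace[OF WP] K(1) by (intro sum_family_least) auto
  moreover have "W + ?P \<subseteq> (\<Sum>k\<in>K. I k)"
    using W(2) D(1) K(1) submodule_subspace[OF sub]
    by (intro set_plus_least sum_family_mono subspace_sum_family) auto
  ultimately show thesis
    using that[OF D] by blast
qed

text \<open>
  With \<open>D\<close> as in the preceding lemma, \<open>P = (\<Sum>k\<in>D. I k)\<close> and \<open>A\<close> the complementary index set, both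
  \<open>W\<close> and \<open>\<Sum>k\<in>A. I k\<close> are complements of \<open>P\<close>.  So the projection \<open>f\<close> to \<open>W\<close> along \<open>P\<close> maps
  \<open>\<Sum>k\<in>A. I k\<close> isomorphically onto \<open>W\<close>, and \<open>I k\<close> is replaced by \<open>f ` I k\<close> for \<open>k \<in> A\<close>.  On a summand
  that is isomorphic to no other one, \<open>x \<mapsto> x - f x\<close> is a homomorphism to \<open>P\<close>, hence zero, and
  the summand is unchanged.
\<close>

lemma submodule_adapted_decomposition:
  assumes dec: "simple_module_decomposition sc br S M n I"
    and W: "submodule_of sc br S W" "W \<subseteq> M"
  obtains I' A where "simple_module_decomposition sc br S M n I'"
    and "\<And>k. k \<in> {1..n} \<Longrightarrow> module_iso sc br S (I k) (I' k)"
    and "\<And>k. k \<in> {1..n} \<Longrightarrow> (\<forall>l\<in>{1..n}. module_iso sc br S (I k) (I l) \<longrightarrow> l = k) \<Longrightarrow> I' k = I k"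
    and "A \<subseteq> {1..n}" "W = (\<Sum>k\<in>A. I' k)"
proof -
  define K where "K = {1..n}"
  have finK: "finite K"
    by (simp add: K_def)
  have simple: "\<And>k. k \<in> K \<Longrightarrow> simple_module sc br S (I k)"
    and indep: "independent_family K I" and M: "M = (\<Sum>k\<in>K. I k)"
    using dec by (simp_all add: simple_module_decomposition_def K_def)
  have sub: "submodule_of sc br S (I k)" "subspace (I k)" if "k \<in> K" for k
    using simple_module_submodule[OF simple[OF that]] submodule_subspace by blast+
  obtain D where D: "D \<subseteq> K" "W \<inter> (\<Sum>k\<in>D. I k) = {0}"
      "W + (\<Sum>k\<in>D. I k) = (\<Sum>k\<in>K. I k)"
    using exists_partial_sum_complement[OF finK simple W(1) W(2)[unfolded M]] .
  define P where "P = (\<Sum>k\<in>D. I k)"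
  define A where "A = K - D"
  define f where "f = component W P"
  define I' where "I' k = (if k \<in> A then f ` I k else I k)" for k
  have fin: "finite A" "finite D" "A \<subseteq> K" "A \<union> D = K" "A \<inter> D = {}"
    using D(1) finK finite_subset[OF D(1) finK] by (auto simp: A_def)
  have P: "submodule_of sc br S P"
    unfolding P_def using D(1) sub by (intro submodule_sum_family) auto
  have sW: "subspace W" and sP: "subspace P"
    using W(1) P by (auto intro: submodule_subspace)
  have WP: "W \<inter> P = {0}" "W + P = M"
    using D(2,3) by (simp_all add: P_def M)
  have IM: "I k \<subseteq> M" if "k \<in> K" for k
    unfolding M using that sub finK by (intro summand_subset_sum_family) auto
  have f_in: "f x \<in> W" "x - f x \<in> P" if "x \<in> M" for x
    using component_in[OF sW sP WP(1)] that by (simp_all add: f_def WP(2))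
  have f_eqv: "equivariant_on S M f"
    using equivariant_on_component[OF W(1) P WP(1)] by (simp add: f_def WP(2))
  have f_eqvI: "equivariant_on S (I k) f" if "k \<in> K" for k
    using equivariant_on_subset[OF f_eqv IM[OF that]] .
  have indepA: "independent_family A I" and indepD: "independent_family D I"
    using independent_family_subset[OF indep finK] fin(3) D(1) sub(2) by blast+
  have AP: "(\<Sum>k\<in>A. I k) \<inter> P = {0}"
    unfolding P_def using fin(3) D(1) fin(5) sub(2) by (rule independent_family_disjoint[OF indep finK])
  (* f is injective on the sum over A: there x - f x lies in P, and the sum over A meets P trivially. *)
  have sum_zero_if: "(\<Sum>k\<in>A. z k) = 0" if "\<And>k. k \<in> A \<Longrightarrow> z k \<in> I k" "(\<Sum>k\<in>A. f (z k)) = 0" for z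
  proof -
    have "(\<Sum>k\<in>A. z k - f (z k)) \<in> P"
      using that(1) IM fin(3) f_in(2) by (intro subspace_sum[OF sP]) blast
    then have "(\<Sum>k\<in>A. z k) \<in> P"
      by (simp add: sum_subtractf that(2))
    moreover have "(\<Sum>k\<in>A. z k) \<in> (\<Sum>k\<in>A. I k)"
      using fin(1) that(1) by (rule sum_in_sum_family)
    ultimately show ?thesis
      using AP by blast
  qed
  have coord_zero_if: "z k = 0" if "\<And>k. k \<in> A \<Longrightarrow> z k \<in> I k" "(\<Sum>k\<in>A. f (z k)) = 0" "k \<in> A" for z k
    using independent_familyD[OF indepA that(1) sum_zero_if[OF that(1,2)] that(3)] .
  have f_zero: "f 0 = 0"
    using equivariant_on_zero[OF f_eqv] W(1) P WP(2) submodule_plus by metis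
  have f_inj: "inj_on f (I k)" if k: "k \<in> A" for k
  proof (rule equivariant_on_inj[OF f_eqvI sub(1)])
    show "x = 0" if x: "x \<in> I k" "f x = 0" for x
    proof -
      let ?z = "\<lambda>l. if l = k then x else 0"
      have "?z l \<in> I l" if "l \<in> A" for l
        using that x(1) subspace_0[OF sub(2)] fin(3) by auto
      moreover have "(\<Sum>l\<in>A. f (?z l)) = 0"
        using x(2) f_zero by (intro sum.neutral) auto
      ultimately have "?z k = 0"
        using k by (rule coord_zero_if)
      then show ?thesis
        by simp
    qed
  qed (use k fin(3) in auto)
  have simple': "simple_module sc br S (I' k)" if "k \<in> K" for k
    using simple[OF that] simple_module_image[OF simple[OF that] f_eqvI[OF that] f_inj]
    by (simp add: I'_def)
  have iso: "module_iso sc br S (I k) (I' k)" if "k \<in> K" for k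
  proof (cases "k \<in> A")
    case True
    then have "bij_betw f (I k) (I' k)"
      using f_inj by (simp add: bij_betw_def I'_def)
    then show ?thesis
      using f_eqvI[OF that] by (auto simp: module_iso_iff)
  qed (simp add: I'_def module_iso_refl)
  have sub': "subspace (I' k)" if "k \<in> K" for k
    using simple_module_submodule[OF simple'[OF that]] by (rule submodule_subspace)
  have sumD: "(\<Sum>k\<in>D. I' k) = P"
    unfolding P_def using fin(5) by (intro sum.cong) (auto simp: I'_def)
  have sumA: "W = (\<Sum>k\<in>A. I' k)"
  proof
    have "I' k \<subseteq> W" if "k \<in> A" for k
      using that f_in(1) IM fin(3) by (simp add: I'_def) blast
    then show "(\<Sum>k\<in>A. I' k) \<subseteq> W"
      using sW fin(1) by (intro sum_family_least)
    show "W \<subseteq> (\<Sum>k\<in>A. I' k)"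
    proof
      fix w assume w: "w \<in> W"
      have "M = (\<Sum>k\<in>A. I k) + P"
        unfolding M P_def fin(4)[symmetric] using fin(1,2,5) by (rule sum.union_disjoint)
      then have "w \<in> (\<Sum>k\<in>A. I k) + P"
        using w W(2) by blast
      then obtain a p where a: "a \<in> (\<Sum>k\<in>A. I k)" and p: "p \<in> P" "w = a + p"
        unfolding in_set_plus_iff by blast
      obtain y where y: "\<And>k. k \<in> A \<Longrightarrow> y k \<in> I k" "a = (\<Sum>k\<in>A. y k)"
        using a unfolding in_sum_family_iff[OF fin(1)] by blast
      have yM: "y k \<in> M" if "k \<in> A" for k
        using y(1)[OF that] IM fin(3) that by blast
      have "w - (\<Sum>k\<in>A. f (y k)) = (\<Sum>k\<in>A. y k - f (y k)) + p"
        by (simp add: p(2) y(2) sum_subtractf)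
      moreover have "(\<Sum>k\<in>A. y k - f (y k)) + p \<in> P"
        by (intro subspace_add[OF sP] subspace_sum[OF sP] f_in(2) yM p(1))
      ultimately have "w - (\<Sum>k\<in>A. f (y k)) \<in> P"
        by simp
      moreover have "w - (\<Sum>k\<in>A. f (y k)) \<in> W"
        by (intro subspace_diff[OF sW] subspace_sum[OF sW] f_in(1) yM w)
      ultimately have "w - (\<Sum>k\<in>A. f (y k)) \<in> W \<inter> P"
        by blast
      then have "w = (\<Sum>k\<in>A. f (y k))"
        unfolding WP(1) by simp
      also have "\<dots> \<in> (\<Sum>k\<in>A. I' k)"
        using fin(1) y(1) by (intro sum_in_sum_family) (auto simp: I'_def)
      finally show "w \<in> (\<Sum>k\<in>A. I' k)" .
    qed
  qed
  have sumK: "M = (\<Sum>k\<in>K. I' k)"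
    using sum.union_disjoint[OF fin(1,2,5), of I'] WP(2) unfolding sumA[symmetric] sumD fin(4) by simp
  have "independent_family A I'"
    unfolding independent_family_def
  proof (intro allI impI ballI)
    fix x k assume x: "(\<forall>k\<in>A. x k \<in> I' k) \<and> (\<Sum>k\<in>A. x k) = 0" and k: "k \<in> A"
    have "\<forall>k\<in>A. \<exists>z. z \<in> I k \<and> x k = f z"
      using x by (auto simp: I'_def)
    then obtain z where z: "\<And>k. k \<in> A \<Longrightarrow> z k \<in> I k" "\<And>k. k \<in> A \<Longrightarrow> x k = f (z k)"
      by metis
    have "(\<Sum>k\<in>A. f (z k)) = 0"
      using x z(2) by simp
    then have "z k = 0"
      using coord_zero_if[OF z(1)] k by blast
    then show "x k = 0"
      using z(2)[OF k] f_zero by simp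
  qed
  moreover have "I' k = I k" if "k \<in> D" for k
    using that fin(5) by (auto simp: I'_def)
  then have "independent_family D I'"
    using indepD unfolding independent_family_def by simp
  moreover have "(\<Sum>k\<in>A. I' k) \<inter> (\<Sum>k\<in>D. I' k) = {0}"
    unfolding sumA[symmetric] sumD by (rule WP(1))
  ultimately have "independent_family (A \<union> D) I'"
    using fin sub' by (intro independent_family_Un) auto
  then have dec': "simple_module_decomposition sc br S M n I'"
    using simple' sumK unfolding fin(4) simple_module_decomposition_def K_def by blast
  have isolated: "I' k = I k"
    if k: "k \<in> K" and iso_only: "\<forall>l\<in>K. module_iso sc br S (I k) (I l) \<longrightarrow> l = k" for k
  proof (cases "k \<in> A")
    case True
    have "x - f x = 0" if x: "x \<in> I k" for x
    proof (rule hom_into_sum_eq_zero[OF fin(2) indepD _ simple[OF k] _ _ _ x])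
      show "simple_module sc br S (I l)" if "l \<in> D" for l
        using simple that D(1) by blast
      show "\<not> module_iso sc br S (I k) (I l)" if "l \<in> D" for l
        using iso_only that D(1) True fin(5) by blast
      show "equivariant_on S (I k) (\<lambda>x. x - f x)"
        using f_eqvI[OF k] by (rule equivariant_on_diff)
      show "(\<lambda>x. x - f x) ` I k \<subseteq> (\<Sum>l\<in>D. I l)"
        using f_in(2) IM[OF k] unfolding P_def by blast
    qed
    then have "f ` I k = (\<lambda>x. x) ` I k"
      by (intro image_cong) simp_all
    then show ?thesis
      using True by (simp add: I'_def)
  qed (simp add: I'_def)
  show thesis
  proof (rule that[OF dec'])
    show "module_iso sc br S (I k) (I' k)" if "k \<in> {1..n}" for k
      using iso that by (simp add: K_def)
    show "I' k = I k" if "k \<in> {1..n}" "\<forall>l\<in>{1..n}. module_iso sc br S (I k) (I l) \<longrightarrow> l = k" for k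
      using isolated that by (simp add: K_def)
    show "A \<subseteq> {1..n}"
      using fin(3) by (simp add: K_def)
  qed (rule sumA)
qed

section \<open>The Leibniz kernel, brackets of subsets and simple Lie subalgebras\<close>

text \<open>
  The Leibniz identity for \<open>[[x, y], y]\<close> contains that product on both sides, leaving \<open>[x, [y, y]] = 0\<close>.
\<close>

lemma br_kernel:
  assumes "y \<in> leibniz_kernel sc br"
  shows "br x y = 0"
proof -
  have "subspace {y. \<forall>x. br x y = 0}"
    by (simp add: subspace_def br_add_right br_scale_right)
  moreover have "br x (br y y) = 0" for x y
    using leibniz[of x y y] by simp
  then have "range (\<lambda>y. br y y) \<subseteq> {y. \<forall>x. br x y = 0}"
    by auto
  ultimately have "leibniz_kernel sc br \<subseteq> {y. \<forall>x. br x y = 0}"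
    unfolding leibniz_kernel_def by (intro span_minimal)
  then show ?thesis
    using assms by blast
qed

lemma subspace_br_preimage: "subspace Z \<Longrightarrow> subspace {x. br x y \<in> Z}"
  by (simp add: subspace_def br_add_left br_scale_left)

lemma kernel_br:
  assumes "u \<in> leibniz_kernel sc br"
  shows "br u x \<in> leibniz_kernel sc br"
proof -
  let ?K = "leibniz_kernel sc br"
  have sK: "subspace ?K" and sq: "br y y \<in> ?K" for y
    by (auto simp: leibniz_kernel_def intro: span_base)
  have "br (br y y) x \<in> ?K" for y
  proof -
    (* [[y,y],x] = [z,y] + [y,z] for z = [y,x], and this is a polarized square. *)
    have "br (br y y) x = br (y + br y x) (y + br y x) - br y y - br (br y x) (br y x)"
      by (simp add: leibniz[of y y x] br_add_left br_add_right algebra_simps)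
    then show ?thesis
      using sq subspace_diff[OF sK] by metis
  qed
  then have "?K \<subseteq> {u. br u x \<in> ?K}"
    using subspace_br_preimage[OF sK, of x] unfolding leibniz_kernel_def
    by (intro span_minimal) auto
  then show ?thesis
    using assms by blast
qed

lemma br_in_bracket_span: "x \<in> X \<Longrightarrow> y \<in> Y \<Longrightarrow> br x y \<in> bracket_span sc br X Y"
  unfolding bracket_span_def by (auto intro: span_base)

lemma subspace_bracket_span: "subspace (bracket_span sc br X Y)"
  by (simp add: bracket_span_def)

lemma bracket_span_least:
  assumes "subspace Z" "\<And>x y. x \<in> X \<Longrightarrow> y \<in> Y \<Longrightarrow> br x y \<in> Z"
  shows "bracket_span sc br X Y \<subseteq> Z"
  unfolding bracket_span_def using assms by (intro span_minimal) auto

text \<open>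
  By the Leibniz identity, \<open>[[x, t], s] = [[x, s], t] + [x, [t, s]]\<close>.
\<close>

lemma submodule_bracket_span:
  assumes M: "submodule_of sc br S M" and T: "\<And>t s. t \<in> T \<Longrightarrow> s \<in> S \<Longrightarrow> br t s \<in> T"
  shows "submodule_of sc br S (bracket_span sc br M T)"
proof -
  have "bracket_span sc br M T \<subseteq> {z. br z s \<in> bracket_span sc br M T}" if s: "s \<in> S" for s
  proof (intro bracket_span_least subspace_br_preimage subspace_bracket_span CollectI)
    fix x t assume "x \<in> M" "t \<in> T"
    then have "br (br x s) t + br x (br t s) \<in> bracket_span sc br M T"
      using M T s
      by (intro subspace_add[OF subspace_bracket_span] br_in_bracket_span) (auto intro: submodule_br)
    then show "br (br x t) s \<in> bracket_span sc br M T"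
      by (simp add: leibniz[of x t s])
  qed
  then show ?thesis
    unfolding submodule_of_def using subspace_bracket_span by blast
qed

lemma simple_lie_perfect:
  assumes S: "simple_lie_subalgebra sc br S"
  shows "bracket_span sc br S S = S"
proof -
  have sub: "subspace S" "\<And>x y. x \<in> S \<Longrightarrow> y \<in> S \<Longrightarrow> br x y \<in> S"
    using S by (auto simp: simple_lie_subalgebra_def subalgebra_def)
  have le: "bracket_span sc br S S \<subseteq> S"
    using sub by (rule bracket_span_least)
  then have "ideal_of sc br S (bracket_span sc br S S)"
    by (auto simp: ideal_of_def subspace_bracket_span intro!: br_in_bracket_span)
  then have "bracket_span sc br S S = {0} \<or> bracket_span sc br S S = S"
    using S by (auto simp: simple_lie_subalgebra_def)
  moreover have "\<not> abelian_subset br S"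
    using S by (auto simp: simple_lie_subalgebra_def)
  then have "bracket_span sc br S S \<noteq> {0}"
    using br_in_bracket_span[of _ S _ S] by (auto simp: abelian_subset_def)
  ultimately show ?thesis
    by simp
qed

text \<open>
  The center is an ideal of \<open>S\<close>, and it is proper because \<open>S\<close> is not abelian.
\<close>

lemma simple_lie_centerless:
  assumes S: "simple_lie_subalgebra sc br S" and x: "x \<in> S" "\<And>y. y \<in> S \<Longrightarrow> br x y = 0"
  shows "x = 0"
proof -
  let ?Z = "{x \<in> S. \<forall>y\<in>S. br x y = 0}"
  have sub: "subspace S" and sq: "\<And>x. x \<in> S \<Longrightarrow> br x x = 0" and nab: "\<not> abelian_subset br S"
    using S by (auto simp: simple_lie_subalgebra_def subalgebra_def)
  have anti: "br y x = - br x y" if "x \<in> S" "y \<in> S" for x y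
    using sq[of "x + y"] sq[OF that(1)] sq[OF that(2)] subspace_add[OF sub that]
    by (simp add: br_add_left br_add_right eq_neg_iff_add_eq_0 add.commute)
  have Z_br: "br z y = 0 \<and> br y z = 0" if "z \<in> ?Z" "y \<in> S" for y z
    using that anti[of z y] by simp
  have "subspace ?Z"
    using sub unfolding subspace_def by (simp add: br_add_left br_scale_left)
  then have "ideal_of sc br S ?Z"
    unfolding ideal_of_def
  proof (intro conjI ballI)
    fix y z assume yz: "y \<in> S" "z \<in> ?Z"
    have "0 \<in> ?Z"
      using \<open>subspace ?Z\<close> by (rule subspace_0)
    then show "br y z \<in> ?Z" "br z y \<in> ?Z"
      by (simp_all only: Z_br[OF yz(2,1)])
  qed auto
  then have "?Z = {0} \<or> ?Z = S"
    using S by (auto simp: simple_lie_subalgebra_def)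
  moreover have "?Z \<noteq> S"
    using nab by (auto simp: abelian_subset_def)
  ultimately show ?thesis
    using x by auto
qed

text \<open>
  As \<open>[S, S] = S\<close>, every term of the derived series of \<open>X\<close> contains \<open>S\<close>.
\<close>

lemma not_solvable_if_simple_lie_subset:
  assumes S: "simple_lie_subalgebra sc br S" and "S \<subseteq> X"
  shows "\<not> solvable sc br X"
proof -
  have "S \<subseteq> derived_series sc br X j" for j
  proof (induction j)
    case (Suc j)
    have "bracket_span sc br S S \<subseteq> derived_series sc br X (Suc j)"
      unfolding bracket_span_def derived_series.simps using Suc by (intro span_mono) auto
    then show ?case
      by (simp only: simple_lie_perfect[OF S])
  qed (use assms in simp)
  moreover have "\<not> S \<subseteq> {0}"
    using S by (auto simp: simple_lie_subalgebra_def abelian_subset_def)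
  ultimately show ?thesis
    by (metis solvable_def)
qed

end

section \<open>Ideals of the Lie algebra and of its extension by the Leibniz kernel\<close>

locale split_leibniz_algebra = leibniz_algebra sc br
  for sc :: "'k::field \<Rightarrow> 'a::ab_group_add \<Rightarrow> 'a" and br +
  fixes G :: "'a set" and m :: nat and g :: "nat \<Rightarrow> 'a set"
  assumes lie: "simple_lie_decomposition sc br G m g"
    and G_plus_kernel: "G + leibniz_kernel sc br = UNIV"
begin

lemma simple_summand: "i \<in> {1..m} \<Longrightarrow> simple_lie_subalgebra sc br (g i)"
  and G_eq: "G = (\<Sum>i\<in>{1..m}. g i)"
  and summands_commute:
    "i \<in> {1..m} \<Longrightarrow> j \<in> {1..m} \<Longrightarrow> i \<noteq> j \<Longrightarrow> x \<in> g i \<Longrightarrow> y \<in> g j \<Longrightarrow> br x y = 0"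
  using lie by (auto simp: simple_lie_decomposition_def)

lemma subspace_summand: "i \<in> {1..m} \<Longrightarrow> subspace (g i)"
  and summand_closed: "i \<in> {1..m} \<Longrightarrow> x \<in> g i \<Longrightarrow> y \<in> g i \<Longrightarrow> br x y \<in> g i"
  using simple_summand by (auto simp: simple_lie_subalgebra_def subalgebra_def)

lemma subspace_G: "subspace G"
  unfolding G_eq using subspace_summand by (rule subspace_sum_family)

lemma summand_subset_G: "i \<in> {1..m} \<Longrightarrow> g i \<subseteq> G"
  unfolding G_eq using subspace_summand by (intro summand_subset_sum_family) auto

lemma br_summand:
  assumes "\<And>j. j \<in> {1..m} \<Longrightarrow> a j \<in> g j" "i \<in> {1..m}" "b \<in> g i"
  shows "br (\<Sum>j\<in>{1..m}. a j) b = br (a i) b" "br b (\<Sum>j\<in>{1..m}. a j) = br b (a i)"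
proof -
  have "(\<Sum>j\<in>{1..m}. br (a j) b) = br (a i) b + (\<Sum>j\<in>{1..m} - {i}. br (a j) b)"
    using assms by (intro sum.remove) auto
  also have "(\<Sum>j\<in>{1..m} - {i}. br (a j) b) = 0"
    using assms by (intro sum.neutral) (auto intro: summands_commute[of _ i])
  finally show "br (\<Sum>j\<in>{1..m}. a j) b = br (a i) b"
    by (simp add: br_sum_left)
  have "(\<Sum>j\<in>{1..m}. br b (a j)) = br b (a i) + (\<Sum>j\<in>{1..m} - {i}. br b (a j))"
    using assms by (intro sum.remove) auto
  also have "(\<Sum>j\<in>{1..m} - {i}. br b (a j)) = 0"
    using assms by (intro sum.neutral) (auto intro: summands_commute[of i])
  finally show "br b (\<Sum>j\<in>{1..m}. a j) = br b (a i)"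
    by (simp add: br_sum_right)
qed

lemma br_G_summand:
  assumes "x \<in> G" "i \<in> {1..m}" "b \<in> g i"
  shows "br x b \<in> g i" "br b x \<in> g i"
proof -
  obtain a where a: "\<And>j. j \<in> {1..m} \<Longrightarrow> a j \<in> g j" "x = (\<Sum>j\<in>{1..m}. a j)"
    using assms(1) unfolding G_eq in_sum_family_iff[OF finite_atLeastAtMost] by blast
  then show "br x b \<in> g i" "br b x \<in> g i"
    using assms by (auto simp: br_summand intro: summand_closed)
qed

lemma ideal_sum_summands:
  assumes B: "B \<subseteq> {1..m}"
  shows "ideal_of sc br G (\<Sum>i\<in>B. g i)"
  unfolding ideal_of_def
proof (intro conjI ballI)
  have fin: "finite B"
    using B finite_subset by blast
  show sub: "subspace (\<Sum>i\<in>B. g i)"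
    using B subspace_summand by (intro subspace_sum_family) auto
  show "(\<Sum>i\<in>B. g i) \<subseteq> G"
    unfolding G_eq using B subspace_summand by (intro sum_family_mono) auto
  fix x y assume x: "x \<in> G" and "y \<in> (\<Sum>i\<in>B. g i)"
  then obtain b where b: "\<And>i. i \<in> B \<Longrightarrow> b i \<in> g i" "y = (\<Sum>i\<in>B. b i)"
    using fin by (auto simp: in_sum_family_iff)
  have "br x (b i) \<in> g i" "br (b i) x \<in> g i" if "i \<in> B" for i
    using x that b(1)[OF that] B br_G_summand by auto
  then show "br x y \<in> (\<Sum>i\<in>B. g i)" "br y x \<in> (\<Sum>i\<in>B. g i)"
    unfolding b(2) br_sum_left br_sum_right using fin by (auto intro: sum_in_sum_family)
qed

text \<open>
  If \<open>g i\<close> is not contained in \<open>P\<close>, then \<open>g i \<inter> P = {0}\<close>.  For \<open>x \<in> P\<close> with component \<open>x\<^sub>i\<close> in \<open>g i\<close>, this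
  forces \<open>[x\<^sub>i, b] = [x, b] = 0\<close> for all \<open>b\<close> in \<open>g i\<close>, so \<open>x\<^sub>i\<close> is central in \<open>g i\<close> and vanishes.
\<close>

lemma ideal_of_G_eq:
  assumes P: "ideal_of sc br G P"
  shows "P = (\<Sum>i\<in>{i \<in> {1..m}. g i \<subseteq> P}. g i)"
proof
  let ?B = "{i \<in> {1..m}. g i \<subseteq> P}"
  have sub: "subspace P" "P \<subseteq> G" "\<And>x y. x \<in> G \<Longrightarrow> y \<in> P \<Longrightarrow> br x y \<in> P \<and> br y x \<in> P"
    using P by (auto simp: ideal_of_def)
  show "(\<Sum>i\<in>?B. g i) \<subseteq> P"
    using sub(1) by (intro sum_family_least) auto
  show "P \<subseteq> (\<Sum>i\<in>?B. g i)"
  proof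
    fix x assume x: "x \<in> P"
    then have "x \<in> G"
      using sub(2) by blast
    then obtain a where a: "\<And>j. j \<in> {1..m} \<Longrightarrow> a j \<in> g j" "x = (\<Sum>j\<in>{1..m}. a j)"
      unfolding G_eq in_sum_family_iff[OF finite_atLeastAtMost] by blast
    have "a i = 0" if i: "i \<in> {1..m}" "i \<notin> ?B" for i
    proof (rule simple_lie_centerless[OF simple_summand[OF i(1)] a(1)[OF i(1)]])
      fix b assume b: "b \<in> g i"
      have "ideal_of sc br (g i) (g i \<inter> P)"
        unfolding ideal_of_def
        using subspace_inter[OF subspace_summand[OF i(1)] sub(1)] summand_subset_G[OF i(1)]
          summand_closed[OF i(1)] sub(3) by blast
      then have "g i \<inter> P = {0} \<or> g i \<inter> P = g i"
        using simple_summand[OF i(1)] by (auto simp: simple_lie_subalgebra_def)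
      then have "g i \<inter> P = {0}"
        using i by auto
      moreover have "br (a i) b \<in> g i"
        using summand_closed a(1) i(1) b by blast
      moreover have "br (a i) b \<in> P"
      proof -
        have "b \<in> G"
          using b summand_subset_G[OF i(1)] by blast
        then have "br x b \<in> P"
          using sub(3) x by blast
        moreover have "br x b = br (a i) b"
          unfolding a(2) using a(1) i(1) b by (rule br_summand(1))
        ultimately show ?thesis
          by simp
      qed
      ultimately show "br (a i) b = 0"
        by blast
    qed
    then have "x = (\<Sum>j\<in>?B. a j)"
      unfolding a(2) by (intro sum.mono_neutral_right) auto
    then show "x \<in> (\<Sum>i\<in>?B. g i)"
      using a(1) by (auto simp: in_sum_family_iff)
  qed
qed

text \<open>
  As \<open>[L, K] = 0\<close>, multiplying \<open>b + v \<in> X + V\<close> by \<open>a + u \<in> G + K\<close> gives \<open>[a, b] + [u, b]\<close> on one side and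
  \<open>[b, a] + [v, a]\<close> on the other; only \<open>[u, b]\<close> is not covered by the hypotheses on \<open>X\<close> and \<open>V\<close>.
\<close>

lemma semidirect_ideal:
  assumes X: "ideal_of sc br G X" and V: "submodule_of sc br G V" "V \<subseteq> leibniz_kernel sc br"
    and act: "\<And>u b. u \<in> leibniz_kernel sc br \<Longrightarrow> b \<in> X \<Longrightarrow> br u b \<in> V"
  shows "leibniz_ideal sc br (X + V)"
  unfolding ideal_of_def
proof (intro conjI ballI)
  have sub: "subspace X" "subspace V" "X \<subseteq> G"
    using X V submodule_subspace by (auto simp: ideal_of_def)
  show "subspace (X + V)"
    using sub by (intro subspace_set_plus)
  fix x y assume "y \<in> X + V"
  then obtain b v where y: "b \<in> X" "v \<in> V" "y = b + v"
    by (auto simp: in_set_plus_iff)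
  obtain a u where x: "a \<in> G" "u \<in> leibniz_kernel sc br" "x = a + u"
    using G_plus_kernel UNIV_I[of x] by (metis in_set_plus_iff)
  have v: "v \<in> leibniz_kernel sc br"
    using V(2) y(2) by blast
  have "br x y = br a b + br u b"
    by (simp add: x(3) y(3) br_add_left br_add_right br_kernel[OF v])
  moreover have "br a b \<in> X" "br b a \<in> X"
    using X x(1) y(1) by (auto simp: ideal_of_def)
  ultimately show "br x y \<in> X + V"
    using act[OF x(2) y(1)] by auto
  have "br y x = br b a + br v a"
    by (simp add: x(3) y(3) br_add_left br_add_right br_kernel[OF x(2)])
  then show "br y x \<in> X + V"
    using \<open>br b a \<in> X\<close> submodule_br[OF V(1) y(2) x(1)] by auto
qed simp

lemma leibniz_ideal_submodule:
  assumes "submodule_of sc br G V" "V \<subseteq> leibniz_kernel sc br"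
  shows "leibniz_ideal sc br V"
proof -
  have "ideal_of sc br G {0}"
    using ideal_sum_summands[of "{}"] by simp
  then show ?thesis
    using semidirect_ideal[of "{0}" V] assms subspace_0[OF submodule_subspace[OF assms(1)]]
    by simp
qed

text \<open>
  \<open>[M, g i]\<close> is a submodule of the simple module \<open>M\<close>: either the two are equal or \<open>g i\<close> acts trivially.
\<close>

lemma br_zero_if_bracket_span_noteq:
  assumes "simple_module sc br G M" "i \<in> {1..m}" "bracket_span sc br M (g i) \<noteq> M"
    and "x \<in> M" "y \<in> g i"
  shows "br x y = 0"
proof -
  have sub: "submodule_of sc br G M"
    using assms(1) by (rule simple_module_submodule)
  have "submodule_of sc br G (bracket_span sc br M (g i))"
    using br_G_summand(2) assms(2) by (intro submodule_bracket_span[OF sub]) auto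
  moreover have "bracket_span sc br M (g i) \<subseteq> M"
    using sub summand_subset_G[OF assms(2)]
    by (intro bracket_span_least) (auto intro: submodule_subspace submodule_br)
  ultimately have "bracket_span sc br M (g i) = {0}"
    using simple_moduleD[OF assms(1)] assms(3) by blast
  then show ?thesis
    using br_in_bracket_span[OF assms(4,5)] by simp
qed

text \<open>
  Summands outside \<open>N(B)\<close> are annihilated by all \<open>g i\<close> with \<open>i \<in> B\<close>, so \<open>[K, \<Sum>i\<in>B. g i]\<close> stays in the sum
  over \<open>N(B)\<close>.
\<close>

lemma leibniz_ideal_neighbours:
  assumes dec: "simple_module_decomposition sc br G (leibniz_kernel sc br) n I"
    and B: "B \<subseteq> {1..m}" and C: "C \<subseteq> {1..n} - neighbours sc br g I n B"
  shows "leibniz_ideal sc br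
    ((\<Sum>i\<in>B. g i) + (\<Sum>j\<in>neighbours sc br g I n B. I j) + (\<Sum>k\<in>C. I k))"
proof -
  let ?N = "neighbours sc br g I n B"
  let ?V = "\<Sum>j\<in>?N \<union> C. I j"
  have simple: "\<And>k. k \<in> {1..n} \<Longrightarrow> simple_module sc br G (I k)"
    and K: "leibniz_kernel sc br = (\<Sum>k\<in>{1..n}. I k)"
    using dec by (auto simp: simple_module_decomposition_def)
  have sub: "submodule_of sc br G (I k)" "subspace (I k)" if "k \<in> {1..n}" for k
    using simple_module_submodule[OF simple[OF that]] submodule_subspace by auto
  have le: "?N \<union> C \<subseteq> {1..n}"
    using C by (auto simp: neighbours_def)
  then have fin: "finite ?N" "finite C" "finite B"
    using B finite_subset[OF le] finite_subset[OF B] by auto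
  have V: "submodule_of sc br G ?V"
    using le sub by (intro submodule_sum_family) auto
  have sV: "subspace ?V"
    using V by (rule submodule_subspace)
  have IV: "I k \<subseteq> ?V" if "k \<in> ?N" for k
    using that le fin sub by (intro summand_subset_sum_family) auto
  have "br u b \<in> ?V" if u: "u \<in> leibniz_kernel sc br" and b: "b \<in> (\<Sum>i\<in>B. g i)" for u b
  proof -
    obtain x where x: "\<And>k. k \<in> {1..n} \<Longrightarrow> x k \<in> I k" "u = (\<Sum>k\<in>{1..n}. x k)"
      using u unfolding K in_sum_family_iff[OF finite_atLeastAtMost] by blast
    obtain a where a: "\<And>i. i \<in> B \<Longrightarrow> a i \<in> g i" "b = (\<Sum>i\<in>B. a i)"
      using b unfolding in_sum_family_iff[OF fin(3)] by blast
    have "br (x k) (a i) \<in> ?V" if ki: "k \<in> {1..n}" "i \<in> B" for k i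
    proof (cases "k \<in> ?N")
      case True
      have "a i \<in> G"
        using a(1) ki(2) B summand_subset_G by blast
      then show ?thesis
        using IV[OF True] submodule_br[OF sub(1)] ki(1) x(1) by blast
    next
      case False
      then have "bracket_span sc br (I k) (g i) \<noteq> I k"
        using ki by (auto simp: neighbours_def adjacent_def)
      then have "br (x k) (a i) = 0"
        using br_zero_if_bracket_span_noteq[OF simple[OF ki(1)]] ki B x(1) a(1) by blast
      then show ?thesis
        using subspace_0[OF sV] by simp
    qed
    then show ?thesis
      unfolding x(2) a(2) br_sum_left br_sum_right by (intro subspace_sum[OF sV])
  qed
  moreover have "?V \<subseteq> leibniz_kernel sc br"
    unfolding K using le sub(2) by (intro sum_family_mono) auto
  ultimately have "leibniz_ideal sc br ((\<Sum>i\<in>B. g i) + ?V)"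
    using ideal_sum_summands[OF B] V by (intro semidirect_ideal) auto
  moreover have "?V = (\<Sum>j\<in>?N. I j) + (\<Sum>k\<in>C. I k)"
    using C fin by (intro sum.union_disjoint) auto
  ultimately show ?thesis
    by (simp add: add.assoc)
qed

text \<open>
  The projection \<open>P\<close> of \<open>J\<close> to \<open>G\<close> satisfies \<open>[L, P] = [L, J] \<subseteq> J\<close>, because \<open>K\<close> is annihilated from the
  left.  For a summand \<open>g i \<subseteq> P\<close> this gives \<open>g i = [g i, g i] \<subseteq> J\<close>; so \<open>P \<subseteq> J\<close> and \<open>J\<close> splits.
\<close>

lemma leibniz_ideal_eq:
  assumes J: "leibniz_ideal sc br J"
  shows "J = (\<Sum>i\<in>{i \<in> {1..m}. g i \<subseteq> J}. g i) + (J \<inter> leibniz_kernel sc br)"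
proof -
  let ?K = "leibniz_kernel sc br"
  define P where "P = {a \<in> G. \<exists>u\<in>?K. a + u \<in> J}"
  have sJ: "subspace J"
    using J by (simp add: ideal_of_def)
  have J_br: "br x y \<in> J" "br y x \<in> J" if "y \<in> J" for x y
    using J that by (auto simp: ideal_of_def)
  have sK: "subspace ?K"
    by (simp add: leibniz_kernel_def)
  have G_closed: "br x y \<in> G" if "x \<in> G" "y \<in> G" for x y
    using ideal_sum_summands[of "{1..m}"] that by (auto simp: ideal_of_def G_eq)
  have br_P: "br x a \<in> J" if a: "a \<in> P" for x a
  proof -
    obtain u where "u \<in> ?K" "a + u \<in> J"
      using a unfolding P_def by blast
    then show ?thesis
      using J_br(1)[of "a + u" x] by (simp add: br_add_right br_kernel)
  qed
  have "ideal_of sc br G P"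
    unfolding ideal_of_def
  proof (intro conjI ballI)
    show "subspace P"
      unfolding subspace_def
    proof (intro conjI ballI allI)
      show "0 \<in> P"
        using subspace_0[OF subspace_G] subspace_0[OF sK] subspace_0[OF sJ] by (force simp: P_def)
    next
      fix x y assume "x \<in> P" "y \<in> P"
      then obtain u v where uv: "x \<in> G" "u \<in> ?K" "x + u \<in> J" "y \<in> G" "v \<in> ?K" "y + v \<in> J"
        by (auto simp: P_def)
      then have "(x + u) + (y + v) \<in> J" "u + v \<in> ?K" "x + y \<in> G"
        by (auto intro: subspace_add sJ sK subspace_G)
      moreover have "(x + u) + (y + v) = (x + y) + (u + v)"
        by (simp add: algebra_simps)
      ultimately show "x + y \<in> P"
        unfolding P_def by auto
    next
      fix c x assume "x \<in> P"
      then obtain u where "x \<in> G" "u \<in> ?K" "x + u \<in> J"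
        by (auto simp: P_def)
      then have "sc c (x + u) \<in> J" "sc c u \<in> ?K" "sc c x \<in> G"
        by (auto intro: subspace_scale sJ sK subspace_G)
      then show "sc c x \<in> P"
        unfolding P_def by (auto simp: scale_right_distrib)
    qed
    show "P \<subseteq> G"
      by (auto simp: P_def)
    fix x a assume x: "x \<in> G" and a: "a \<in> P"
    have "br x a + 0 \<in> J" "0 \<in> ?K" "br x a \<in> G"
      using br_P[OF a] subspace_0[OF sK] G_closed[OF x] a by (auto simp: P_def)
    then show "br x a \<in> P"
      unfolding P_def by blast
    obtain u where u: "u \<in> ?K" "a + u \<in> J"
      using a by (auto simp: P_def)
    have "br a x \<in> G"
      using G_closed x a by (auto simp: P_def)
    moreover have "br u x \<in> ?K"
      using u(1) by (rule kernel_br)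
    moreover have "br a x + br u x \<in> J"
      using J_br(2)[OF u(2), of x] by (simp add: br_add_left)
    ultimately show "br a x \<in> P"
      unfolding P_def by blast
  qed
  note P_eq = ideal_of_G_eq[OF this]
  have gJ: "g i \<subseteq> J" if i: "i \<in> {1..m}" "g i \<subseteq> P" for i
  proof -
    have "bracket_span sc br (g i) (g i) \<subseteq> J"
      using br_P i(2) by (intro bracket_span_least sJ) auto
    then show ?thesis
      by (simp only: simple_lie_perfect[OF simple_summand[OF i(1)]])
  qed
  have "g i \<subseteq> P" if "i \<in> {1..m}" "g i \<subseteq> J" for i
    using that summand_subset_G[OF that(1)] subspace_0[OF sK] by (force simp: P_def)
  then have B: "{i \<in> {1..m}. g i \<subseteq> J} = {i \<in> {1..m}. g i \<subseteq> P}"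
    using gJ by blast
  have PJ: "P \<subseteq> J"
    using gJ by (subst P_eq) (intro sum_family_least sJ, auto)
  have "J = P + (J \<inter> ?K)"
  proof
    show "J \<subseteq> P + (J \<inter> ?K)"
    proof
      fix x assume x: "x \<in> J"
      obtain a u where au: "a \<in> G" "u \<in> ?K" "x = a + u"
        using G_plus_kernel UNIV_I[of x] by (metis in_set_plus_iff)
      then have a: "a \<in> P"
        using x by (auto simp: P_def)
      then have "x - a \<in> J"
        using x PJ by (auto intro: subspace_diff[OF sJ])
      then show "x \<in> P + (J \<inter> ?K)"
        using a au by auto
    qed
    show "P + (J \<inter> ?K) \<subseteq> J"
      using PJ sJ by (intro set_plus_least) auto
  qed
  then show ?thesis
    unfolding B P_eq[symmetric] .
qed

text \<open>
  For \<open>g i \<subseteq> J\<close> and \<open>j\<close> adjacent to \<open>i\<close>, \<open>I j = [I j, g i] \<subseteq> J \<inter> K\<close>; by independence the index \<open>j\<close> then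
  occurs in \<open>A\<close>.  So \<open>C\<close> can be taken as \<open>A - N(B)\<close>.
\<close>

lemma leibniz_ideal_classification:
  assumes dec: "simple_module_decomposition sc br G (leibniz_kernel sc br) n I"
    and J: "leibniz_ideal sc br J"
    and A: "A \<subseteq> {1..n}" "J \<inter> leibniz_kernel sc br = (\<Sum>k\<in>A. I k)"
  shows "J = (\<Sum>k\<in>A. I k) \<or>
    (\<exists>B C. B \<noteq> {} \<and> B \<subseteq> {1..m} \<and> C \<subseteq> {1..n} - neighbours sc br g I n B \<and>
       J = (\<Sum>i\<in>B. g i) + (\<Sum>j\<in>neighbours sc br g I n B. I j) + (\<Sum>k\<in>C. I k))"
proof -
  define B where "B = {i \<in> {1..m}. g i \<subseteq> J}"
  let ?N = "neighbours sc br g I n B"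
  have J_eq: "J = (\<Sum>i\<in>B. g i) + (\<Sum>k\<in>A. I k)"
    using leibniz_ideal_eq[OF J] A(2) by (simp add: B_def)
  have K: "leibniz_kernel sc br = (\<Sum>k\<in>{1..n}. I k)" and indep: "independent_family {1..n} I"
    and simple: "\<And>k. k \<in> {1..n} \<Longrightarrow> simple_module sc br G (I k)"
    using dec by (auto simp: simple_module_decomposition_def)
  have sub: "subspace (I k)" if "k \<in> {1..n}" for k
    using simple[OF that] simple_module_submodule submodule_subspace by blast
  have sJ: "subspace J"
    using J by (simp add: ideal_of_def)
  have fin: "finite A"
    using A(1) finite_subset by blast
  have NA: "?N \<subseteq> A"
  proof
    fix j assume "j \<in> ?N"
    then obtain i where j: "j \<in> {1..n}" "i \<in> B" "bracket_span sc br (I j) (g i) = I j"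
      by (auto simp: neighbours_def adjacent_def)
    have "bracket_span sc br (I j) (g i) \<subseteq> J"
      using j(2) J by (intro bracket_span_least sJ) (auto simp: B_def ideal_of_def)
    moreover have "I j \<subseteq> leibniz_kernel sc br"
      unfolding K using j(1) sub by (intro summand_subset_sum_family) auto
    ultimately have le: "I j \<subseteq> (\<Sum>k\<in>A. I k)"
      using j(3) A(2) by auto
    show "j \<in> A"
    proof (rule ccontr)
      assume "j \<notin> A"
      then have "(\<Sum>k\<in>A. I k) \<inter> (\<Sum>k\<in>{j}. I k) = {0}"
        using A(1) j(1) sub by (intro independent_family_disjoint[OF indep]) auto
      then have "I j = {0}"
        using le subspace_0[OF sub[OF j(1)]] by auto
      then show False
        using simple[OF j(1)] by (simp add: simple_module_def)
    qed
  qed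
  show ?thesis
  proof (cases "B = {}")
    case True
    then show ?thesis
      using J_eq by simp
  next
    case False
    have "(\<Sum>k\<in>A. I k) = (\<Sum>k\<in>A - ?N. I k) + (\<Sum>k\<in>?N. I k)"
      using NA fin by (rule sum.subset_diff)
    then have "J = (\<Sum>i\<in>B. g i) + (\<Sum>j\<in>?N. I j) + (\<Sum>k\<in>A - ?N. I k)"
      using J_eq by (simp add: ac_simps)
    then show ?thesis
      using False A(1) by (intro disjI2 exI[of _ B] exI[of _ "A - ?N"]) (auto simp: B_def)
  qed
qed

end

theorem theorem1p7:
  fixes sc :: "'k::field_char_0 \<Rightarrow> 'a::ab_group_add \<Rightarrow> 'a"
    and br :: "'a \<Rightarrow> 'a \<Rightarrow> 'a"
    and Basis G :: "'a set"
    and m n :: nat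
    and g I :: "nat \<Rightarrow> 'a set"
  assumes "leibniz_algebra sc br"
    and "finite_dimensional_vector_space sc Basis"
    and "indecomposable_leibniz sc br"
    and "semisimple_leibniz sc br"
    and "simple_lie_decomposition sc br G m g"
    and "simple_module_decomposition sc br G (leibniz_kernel sc br) n I"
    and "G + leibniz_kernel sc br = UNIV"
    and "G \<inter> leibniz_kernel sc br = {0}"
  shows
    "(\<forall>A. A \<subseteq> {1..n} \<longrightarrow>
        leibniz_ideal sc br (\<Sum>k\<in>A. I k) \<and> abelian_subset br (\<Sum>k\<in>A. I k)) \<and>
     (\<forall>B C. B \<noteq> {} \<and> B \<subseteq> {1..m} \<and> C \<subseteq> {1..n} - neighbours sc br g I n B \<longrightarrow>
        leibniz_ideal sc br
          ((\<Sum>i\<in>B. g i) + (\<Sum>j\<in>neighbours sc br g I n B. I j) + (\<Sum>k\<in>C. I k)) \<and>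
        \<not> solvable sc br
          ((\<Sum>i\<in>B. g i) + (\<Sum>j\<in>neighbours sc br g I n B. I j) + (\<Sum>k\<in>C. I k))) \<and>
     (\<forall>J. leibniz_ideal sc br J \<longrightarrow>
        (\<exists>I'. simple_module_decomposition sc br G (leibniz_kernel sc br) n I' \<and>
          (\<forall>k\<in>{1..n}. module_iso sc br G (I k) (I' k)) \<and>
          (\<forall>k\<in>{1..n}. (\<forall>l\<in>{1..n}. module_iso sc br G (I k) (I l) \<longrightarrow> l = k) \<longrightarrow> I' k = I k) \<and>
          ((\<exists>A. A \<subseteq> {1..n} \<and> J = (\<Sum>k\<in>A. I' k)) \<or>
           (\<exists>B C. B \<noteq> {} \<and> B \<subseteq> {1..m} \<and> C \<subseteq> {1..n} - neighbours sc br g I' n B \<and>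
              J = (\<Sum>i\<in>B. g i) + (\<Sum>j\<in>neighbours sc br g I' n B. I' j) + (\<Sum>k\<in>C. I' k)))))"
proof -
  interpret leibniz_algebra sc br by fact
  interpret split_leibniz_algebra sc br G m g
    by unfold_locales fact+
  let ?K = "leibniz_kernel sc br"
  note dec = \<open>simple_module_decomposition sc br G ?K n I\<close>
  have sub: "submodule_of sc br G (I k)" if "k \<in> {1..n}" for k
    using dec that by (simp add: simple_module_decomposition_def simple_module_submodule)
  have sub_sum: "submodule_of sc br G (\<Sum>k\<in>A. I k)" "(\<Sum>k\<in>A. I k) \<subseteq> ?K" if "A \<subseteq> {1..n}" for A
  proof -
    show "submodule_of sc br G (\<Sum>k\<in>A. I k)"
      using that sub by (intro submodule_sum_family) auto
    have K: "?K = (\<Sum>k\<in>{1..n}. I k)"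
      using dec by (simp add: simple_module_decomposition_def)
    show "(\<Sum>k\<in>A. I k) \<subseteq> ?K"
      unfolding K using that submodule_subspace[OF sub] by (intro sum_family_mono) auto
  qed
  show ?thesis
  proof (intro conjI allI impI)
    show "leibniz_ideal sc br (\<Sum>k\<in>A. I k)" "abelian_subset br (\<Sum>k\<in>A. I k)"
      if "A \<subseteq> {1..n}" for A
      using sub_sum[OF that] leibniz_ideal_submodule br_kernel by (auto simp: abelian_subset_def)
  next
    fix B C assume "B \<noteq> {} \<and> B \<subseteq> {1..m} \<and> C \<subseteq> {1..n} - neighbours sc br g I n B"
    then have B: "B \<noteq> {}" "B \<subseteq> {1..m}" and C: "C \<subseteq> {1..n} - neighbours sc br g I n B"
      by auto
    let ?J = "(\<Sum>i\<in>B. g i) + (\<Sum>j\<in>neighbours sc br g I n B. I j) + (\<Sum>k\<in>C. I k)"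
    show "leibniz_ideal sc br ?J"
      using dec B(2) C by (rule leibniz_ideal_neighbours)
    obtain i where i: "i \<in> B"
      using B by blast
    have "g i \<subseteq> (\<Sum>i\<in>B. g i)"
      using i B(2) subspace_summand finite_subset[OF B(2)]
      by (intro summand_subset_sum_family) auto
    moreover have "0 \<in> (\<Sum>j\<in>neighbours sc br g I n B. I j)" "0 \<in> (\<Sum>k\<in>C. I k)"
      using C by (intro subspace_0[OF submodule_subspace[OF sub_sum(1)]]; auto simp: neighbours_def)+
    ultimately have "g i \<subseteq> ?J"
      by (force simp: in_set_plus_iff)
    then show "\<not> solvable sc br ?J"
      using not_solvable_if_simple_lie_subset simple_summand i B(2) by blast
  next
    fix J assume J: "leibniz_ideal sc br J"
    have "submodule_of sc br G (J \<inter> ?K)"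
      using J kernel_br unfolding ideal_of_def submodule_of_def
      by (auto simp: leibniz_kernel_def intro: subspace_inter)
    then obtain I' A where I': "simple_module_decomposition sc br G ?K n I'"
        "\<And>k. k \<in> {1..n} \<Longrightarrow> module_iso sc br G (I k) (I' k)"
        "\<And>k. k \<in> {1..n} \<Longrightarrow> (\<forall>l\<in>{1..n}. module_iso sc br G (I k) (I l) \<longrightarrow> l = k) \<Longrightarrow> I' k = I k"
      and A: "A \<subseteq> {1..n}" "J \<inter> ?K = (\<Sum>k\<in>A. I' k)"
      using submodule_adapted_decomposition[OF dec _ Int_lower2] by metis
    have "(\<exists>A. A \<subseteq> {1..n} \<and> J = (\<Sum>k\<in>A. I' k)) \<or>
       (\<exists>B C. B \<noteq> {} \<and> B \<subseteq> {1..m} \<and> C \<subseteq> {1..n} - neighbours sc br g I' n B \<and>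
          J = (\<Sum>i\<in>B. g i) + (\<Sum>j\<in>neighbours sc br g I' n B. I' j) + (\<Sum>k\<in>C. I' k))"
      using leibniz_ideal_classification[OF I'(1) J A] A(1) by blast
    then show "\<exists>I'. simple_module_decomposition sc br G ?K n I' \<and>
        (\<forall>k\<in>{1..n}. module_iso sc br G (I k) (I' k)) \<and>
        (\<forall>k\<in>{1..n}. (\<forall>l\<in>{1..n}. module_iso sc br G (I k) (I l) \<longrightarrow> l = k) \<longrightarrow> I' k = I k) \<and>
        ((\<exists>A. A \<subseteq> {1..n} \<and> J = (\<Sum>k\<in>A. I' k)) \<or>
         (\<exists>B C. B \<noteq> {} \<and> B \<subseteq> {1..m} \<and> C \<subseteq> {1..n} - neighbours sc br g I' n B \<and>
            J = (\<Sum>i\<in>B. g i) + (\<Sum>j\<in>neighbours sc br g I' n B. I' j) + (\<Sum>k\<in>C. I' k)))"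
      by (intro exI[of _ I'] conjI ballI impI) (rule I' | assumption)+
  qed
qed

end
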